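(* (1) The trace preservation problem is undecidable for L/U-PTA with at least one lower-bound parameter and at least one upper-bound parameter. (2) The robust language preservation problem and the robust trace preservation problem are undecidable for L/U-PTA with at least one lower-bound parameter and at least one upper-bound parameter.
   Context: Clocks are real-valued; parameters take nonnegative rational values. Atomic constraints: $x\sim p+c$, $x\sim c$, $p\sim c$; a PTA $(\Sigma,L,\ell_0,X,P,I,E)$ has invariants and edges $(\ell,g,a,R,\ell')$. An L/U-PTA is a PTA whose parameters are partitioned into lower-bound parameters (only used as lower bounds on clocks in constraints) and upper-bound parameters (only used as upper bounds). For parameter valuation $v$, $v(\mathcal A)$ is the timed automaton obtained by substituting parameter values, with steps for delay $d\ge0$ when $w+d$ satisfies the guard and $w'=(w+d)[R\mapsto0]$. A run is a maximal step sequence $s_0\xrightarrow{d_0,e_0}s_1\cdots$ from $(\ell_0,\mathbf 0)$; its untimed word is the action sequence and its untimed trace is $(\ell_i,a_i)_i$; $\mathcal L(v(\mathcal A))$ and $\mathrm{Traces}(v(\mathcal A))$ are the sets of these. Trace preservation: given $\mathcal A,v$, decide whether some $v'\ne v$ has $\mathrm{Traces}(v'(\mathcal A))=\mathrm{Traces}(v(\mathcal A))$. Robust versions: decide whether some $v'\neq v$ has the same language (resp. trace set) as $v$ for every valuation $\lambda v+(1-\lambda)v'$, $\lambda\in[0,1]$. *)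

theory Defs
  imports Complex_Main "HOL-Library.Nat_Bijection" "HOL-Library.Extended_Nat"
begin

section \<open>Parametric timed automata\<close>

text \<open>
  Actions, locations, clocks and parameters are named by natural numbers, so that a parametric
  timed automaton (PTA) is a finite object that can be given as input to an algorithm.
\<close>

type_synonym action = nat
type_synonym loc = nat
type_synonym clock = nat
type_synonym param = nat

datatype cmp = Lt | Le | Eq | Ge | Gt

fun cmp_holds :: "cmp \<Rightarrow> real \<Rightarrow> real \<Rightarrow> bool" where
  "cmp_holds Lt a b \<longleftrightarrow> a < b"
| "cmp_holds Le a b \<longleftrightarrow> a \<le> b"
| "cmp_holds Eq a b \<longleftrightarrow> a = b"
| "cmp_holds Ge a b \<longleftrightarrow> a \<ge> b"
| "cmp_holds Gt a b \<longleftrightarrow> a > b"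

text \<open>The three forms of atoms are \<open>x ~ p + c\<close>, \<open>x ~ c\<close> and \<open>p ~ c\<close>.\<close>

datatype atom =
    ClockParam clock cmp param int
  | ClockConst clock cmp int
  | ParamConst param cmp int

text \<open>A constraint is the conjunction of the listed atoms.\<close>

type_synonym constr = "atom list"

datatype edge =
  Edge (src: loc) (guard: constr) (act: action) (resets: "clock set") (tgt: loc)

record pta =
  acts :: "action set"
  locs :: "loc set"
  init :: loc
  clocks :: "clock set"
  params :: "param set"
  invar :: "loc \<Rightarrow> constr"
  edges :: "edge set"

fun wf_atom :: "pta \<Rightarrow> atom \<Rightarrow> bool" where
  "wf_atom A (ClockParam x r p c) \<longleftrightarrow> x \<in> clocks A \<and> p \<in> params A"
| "wf_atom A (ClockConst x r c) \<longleftrightarrow> x \<in> clocks A"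
| "wf_atom A (ParamConst p r c) \<longleftrightarrow> p \<in> params A"

definition wf_edge :: "pta \<Rightarrow> edge \<Rightarrow> bool" where
  "wf_edge A e \<longleftrightarrow> src e \<in> locs A \<and> list_all (wf_atom A) (guard e) \<and> act e \<in> acts A
     \<and> resets e \<subseteq> clocks A \<and> tgt e \<in> locs A"

text \<open>The last conjunct makes \<open>invar\<close> a function on the locations: it has a default value elsewhere.\<close>

definition wf_pta :: "pta \<Rightarrow> bool" where
  "wf_pta A \<longleftrightarrow>
     finite (acts A) \<and> finite (locs A) \<and> finite (clocks A) \<and> finite (params A) \<and> finite (edges A)
     \<and> init A \<in> locs A
     \<and> (\<forall>e\<in>edges A. wf_edge A e)
     \<and> (\<forall>l\<in>locs A. list_all (wf_atom A) (invar A l))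
     \<and> (\<forall>l. l \<notin> locs A \<longrightarrow> invar A l = [])"

subsection \<open>L/U-PTAs\<close>

definition atoms :: "pta \<Rightarrow> atom set" where
  "atoms A = (\<Union>e\<in>edges A. set (guard e)) \<union> (\<Union>l\<in>locs A. set (invar A l))"

text \<open>
  Parameters may occur only as bounds on clocks. So no atom \<open>p ~ c\<close> is allowed, and neither is
  \<open>x = p + c\<close>, which bounds \<open>x\<close> from both sides.
\<close>

fun lu_atom :: "param set \<Rightarrow> param set \<Rightarrow> atom \<Rightarrow> bool" where
  "lu_atom Lo Up (ClockParam x r p c) \<longleftrightarrow>
     (p \<in> Lo \<longrightarrow> r \<in> {Ge, Gt}) \<and> (p \<in> Up \<longrightarrow> r \<in> {Le, Lt})"
| "lu_atom Lo Up (ClockConst x r c) \<longleftrightarrow> True"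
| "lu_atom Lo Up (ParamConst p r c) \<longleftrightarrow> False"

definition lu_partition :: "pta \<Rightarrow> param set \<Rightarrow> param set \<Rightarrow> bool" where
  "lu_partition A Lo Up \<longleftrightarrow>
     Lo \<union> Up = params A \<and> Lo \<inter> Up = {} \<and> (\<forall>a\<in>atoms A. lu_atom Lo Up a)"

section \<open>Semantics\<close>

type_synonym pvaluation = "param \<Rightarrow> rat"
type_synonym cvaluation = "clock \<Rightarrow> real"
type_synonym state = "loc \<times> cvaluation"

text \<open>
  A parameter valuation of \<open>A\<close> is a function from \<open>params A\<close> to the nonnegative rationals. It is
  represented by its extension with 0, so that valuations differ iff they differ on \<open>params A\<close>.
\<close>

definition pvaluations :: "pta \<Rightarrow> pvaluation set" where
  "pvaluations A = {v. (\<forall>p\<in>params A. v p \<ge> 0) \<and> (\<forall>p. p \<notin> params A \<longrightarrow> v p = 0)}"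

fun sat_atom :: "pvaluation \<Rightarrow> cvaluation \<Rightarrow> atom \<Rightarrow> bool" where
  "sat_atom v w (ClockParam x r p c) \<longleftrightarrow> cmp_holds r (w x) (of_rat (v p) + of_int c)"
| "sat_atom v w (ClockConst x r c) \<longleftrightarrow> cmp_holds r (w x) (of_int c)"
| "sat_atom v w (ParamConst p r c) \<longleftrightarrow> cmp_holds r (of_rat (v p)) (of_int c)"

definition sat :: "pvaluation \<Rightarrow> cvaluation \<Rightarrow> constr \<Rightarrow> bool" where
  "sat v w g \<longleftrightarrow> list_all (sat_atom v w) g"

definition delay :: "cvaluation \<Rightarrow> real \<Rightarrow> cvaluation" where
  "delay w d = (\<lambda>x. w x + d)"

definition reset :: "clock set \<Rightarrow> cvaluation \<Rightarrow> cvaluation" where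
  "reset R w = (\<lambda>x. if x \<in> R then 0 else w x)"

definition states :: "pta \<Rightarrow> pvaluation \<Rightarrow> state set" where
  "states A v = {(l, w). l \<in> locs A \<and> (\<forall>x. w x \<ge> 0) \<and> sat v w (invar A l)}"

text \<open>
  Constraints define convex sets of clock valuations, so an invariant that holds before and after a
  delay holds throughout.
\<close>

definition step :: "pta \<Rightarrow> pvaluation \<Rightarrow> state \<Rightarrow> real \<Rightarrow> edge \<Rightarrow> state \<Rightarrow> bool" where
  "step A v s d e s' \<longleftrightarrow>
     s \<in> states A v \<and> s' \<in> states A v \<and> e \<in> edges A \<and> d \<ge> 0 \<and> fst s = src e
     \<and> sat v (delay (snd s) d) (invar A (src e))
     \<and> sat v (delay (snd s) d) (guard e)
     \<and> s' = (tgt e, reset (resets e) (delay (snd s) d))"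

text \<open>
  \<open>run A v n s d e\<close>: the states \<open>s i\<close>, delays \<open>d i\<close> and edges \<open>e i\<close> form a maximal run with \<open>n\<close>
  steps (\<open>n\<close> may be infinite). A finite run is maximal iff its last state has no outgoing step. The
  values of \<open>d\<close>, \<open>e\<close> from index \<open>n\<close> on, and of \<open>s\<close> after index \<open>n\<close>, are irrelevant.
\<close>

definition run ::
  "pta \<Rightarrow> pvaluation \<Rightarrow> enat \<Rightarrow> (nat \<Rightarrow> state) \<Rightarrow> (nat \<Rightarrow> real) \<Rightarrow> (nat \<Rightarrow> edge) \<Rightarrow> bool" where
  "run A v n s d e \<longleftrightarrow>
     s 0 = (init A, \<lambda>x. 0) \<and> s 0 \<in> states A v
     \<and> (\<forall>i. enat i < n \<longrightarrow> step A v (s i) (d i) (e i) (s (Suc i)))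
     \<and> (\<forall>k. n = enat k \<longrightarrow> \<not> (\<exists>d' e' s'. step A v (s k) d' e' s'))"

datatype 'a word = Fin "'a list" | Inf "nat \<Rightarrow> 'a"

definition word_of :: "enat \<Rightarrow> (nat \<Rightarrow> 'a) \<Rightarrow> 'a word" where
  "word_of n f = (case n of enat k \<Rightarrow> Fin (map f [0..<k]) | \<infinity> \<Rightarrow> Inf f)"

definition language :: "pta \<Rightarrow> pvaluation \<Rightarrow> action word set" where
  "language A v = {word_of n (\<lambda>i. act (e i)) |n s d e. run A v n s d e}"

definition traces :: "pta \<Rightarrow> pvaluation \<Rightarrow> (loc \<times> action) word set" where
  "traces A v = {word_of n (\<lambda>i. (fst (s i), act (e i))) |n s d e. run A v n s d e}"

section \<open>Preservation problems\<close>

definition trace_preservation :: "pta \<times> pvaluation \<Rightarrow> bool" where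
  "trace_preservation = (\<lambda>(A, v). \<exists>v'\<in>pvaluations A. v' \<noteq> v \<and> traces A v' = traces A v)"

text \<open>
  The valuations \<open>tv + (1-t)v'\<close> with \<open>t \<in> [0, 1]\<close>. Parameters take rational values, so only those
  \<open>t\<close> count for which all values are rational.
\<close>

definition segment :: "pta \<Rightarrow> pvaluation \<Rightarrow> pvaluation \<Rightarrow> pvaluation set" where
  "segment A v v' = {u \<in> pvaluations A. \<exists>t\<in>{0..1::real}.
     \<forall>p. of_rat (u p) = t * of_rat (v p) + (1 - t) * of_rat (v' p)}"

definition robust_language_preservation :: "pta \<times> pvaluation \<Rightarrow> bool" where
  "robust_language_preservation = (\<lambda>(A, v). \<exists>v'\<in>pvaluations A. v' \<noteq> v \<and>
     (\<forall>u\<in>segment A v v'. language A u = language A v))"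

definition robust_trace_preservation :: "pta \<times> pvaluation \<Rightarrow> bool" where
  "robust_trace_preservation = (\<lambda>(A, v). \<exists>v'\<in>pvaluations A. v' \<noteq> v \<and>
     (\<forall>u\<in>segment A v v'. traces A u = traces A v))"

definition lu_instances :: "(pta \<times> pvaluation) set" where
  "lu_instances = {(A, v). wf_pta A \<and> v \<in> pvaluations A \<and>
     (\<exists>Lo Up. lu_partition A Lo Up \<and> Lo \<noteq> {} \<and> Up \<noteq> {})}"

section \<open>Decidability\<close>

text \<open>Partial recursive functions, with composition \<open>Cn\<close>, primitive recursion \<open>Pr\<close> (on the first
  argument) and minimisation \<open>Mn\<close>; \<open>rec_eval f xs y\<close> means that \<open>f\<close> terminates on \<open>xs\<close> with value
  \<open>y\<close>.\<close>

datatype recf = Z | S | Proj nat | Cn recf "recf list" | Pr recf recf | Mn recf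

inductive rec_eval :: "recf \<Rightarrow> nat list \<Rightarrow> nat \<Rightarrow> bool" where
  zero: "rec_eval Z xs 0"
| succ: "rec_eval S (x # xs) (Suc x)"
| proj: "i < length xs \<Longrightarrow> rec_eval (Proj i) xs (xs ! i)"
| comp: "length ys = length gs \<Longrightarrow> \<forall>i<length gs. rec_eval (gs ! i) xs (ys ! i) \<Longrightarrow>
    rec_eval f ys y \<Longrightarrow> rec_eval (Cn f gs) xs y"
| prim_0: "rec_eval f xs y \<Longrightarrow> rec_eval (Pr f g) (0 # xs) y"
| prim_Suc: "rec_eval (Pr f g) (n # xs) y \<Longrightarrow> rec_eval g (n # y # xs) z \<Longrightarrow>
    rec_eval (Pr f g) (Suc n # xs) z"
| mini: "rec_eval f (n # xs) 0 \<Longrightarrow> \<forall>m<n. \<exists>k. rec_eval f (m # xs) (Suc k) \<Longrightarrow>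
    rec_eval (Mn f) xs n"

text \<open>
  Decidability of the problem \<open>Q\<close> for the instances in \<open>D\<close>, which are coded by \<open>code\<close>. Nothing is
  required of the algorithm on numbers that code no instance.
\<close>

definition decidable_on :: "('i \<Rightarrow> nat) \<Rightarrow> 'i set \<Rightarrow> ('i \<Rightarrow> bool) \<Rightarrow> bool" where
  "decidable_on code D Q \<longleftrightarrow>
     (\<exists>f. \<forall>x\<in>D. rec_eval f [code x] (if Q x then 1 else 0))"

subsection \<open>Coding of instances\<close>

fun cmp_code :: "cmp \<Rightarrow> nat" where
  "cmp_code Lt = 0"
| "cmp_code Le = 1"
| "cmp_code Eq = 2"
| "cmp_code Ge = 3"
| "cmp_code Gt = 4"

fun atom_code :: "atom \<Rightarrow> nat" where
  "atom_code (ClockParam x r p c) = list_encode [0, x, cmp_code r, p, int_encode c]"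
| "atom_code (ClockConst x r c) = list_encode [1, x, cmp_code r, int_encode c]"
| "atom_code (ParamConst p r c) = list_encode [2, p, cmp_code r, int_encode c]"

definition constr_code :: "constr \<Rightarrow> nat" where
  "constr_code g = list_encode (map atom_code g)"

fun edge_code :: "edge \<Rightarrow> nat" where
  "edge_code (Edge l g a R l') = list_encode [l, constr_code g, a, set_encode R, l']"

definition rat_code :: "rat \<Rightarrow> nat" where
  "rat_code q = (case quotient_of q of (a, b) \<Rightarrow> prod_encode (int_encode a, int_encode b))"

definition graph_code :: "nat set \<Rightarrow> (nat \<Rightarrow> nat) \<Rightarrow> nat" where
  "graph_code X f = set_encode ((\<lambda>x. prod_encode (x, f x)) ` X)"

definition instance_code :: "pta \<times> pvaluation \<Rightarrow> nat" where
  "instance_code = (\<lambda>(A, v). list_encode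
     [set_encode (acts A), set_encode (locs A), init A, set_encode (clocks A),
      set_encode (params A), graph_code (locs A) (\<lambda>l. constr_code (invar A l)),
      set_encode (edge_code ` edges A), graph_code (params A) (\<lambda>p. rat_code (v p))])"

text \<open>The coding is faithful: an instance is determined by its code.\<close>

lemma inj_cmp_code: "inj cmp_code"
proof (rule injI)
  fix a b show "cmp_code a = cmp_code b \<Longrightarrow> a = b" by (cases a; cases b) auto
qed

lemma inj_atom_code: "inj atom_code"
proof (rule injI)
  fix a b show "atom_code a = atom_code b \<Longrightarrow> a = b"
    by (cases a; cases b)
      (auto simp: list_encode_eq int_encode_eq inj_eq[OF inj_cmp_code] simp del: list_encode.simps)
qed

lemma inj_constr_code: "inj constr_code"
  by (rule injI) (auto simp: constr_code_def list_encode_eq inj_map_eq_map[OF inj_atom_code])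

lemma inj_on_edge_code: "inj_on edge_code {e. finite (resets e)}"
proof (rule inj_onI)
  fix a b show "a \<in> {e. finite (resets e)} \<Longrightarrow> b \<in> {e. finite (resets e)} \<Longrightarrow>
    edge_code a = edge_code b \<Longrightarrow> a = b"
    by (cases a; cases b)
      (auto simp: list_encode_eq set_encode_eq inj_eq[OF inj_constr_code] simp del: list_encode.simps)
qed

lemma inj_rat_code: "inj rat_code"
  by (rule injI)
    (auto simp: rat_code_def int_encode_eq quotient_of_inject_eq[symmetric] split: prod.splits)

lemma graph_code_eqD:
  assumes "finite X" "graph_code X f = graph_code X g" "x \<in> X"
  shows "f x = g x"
proof -
  have "(\<lambda>x. prod_encode (x, f x)) ` X = (\<lambda>x. prod_encode (x, g x)) ` X"
    using assms(1,2) by (simp add: graph_code_def set_encode_eq)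
  then have "prod_encode (x, f x) \<in> (\<lambda>x. prod_encode (x, g x)) ` X"
    using assms(3) by blast
  then show ?thesis by auto
qed

lemma inj_on_instance_code: "inj_on instance_code lu_instances"
proof (rule inj_onI, clarify)
  fix A B :: pta and v w :: pvaluation
  assume "(A, v) \<in> lu_instances" "(B, w) \<in> lu_instances"
    and eq: "instance_code (A, v) = instance_code (B, w)"
  then have wf: "wf_pta A" "wf_pta B" "v \<in> pvaluations A" "w \<in> pvaluations B"
    by (auto simp: lu_instances_def)
  then have fin: "finite (acts A)" "finite (acts B)" "finite (locs A)" "finite (locs B)"
    "finite (clocks A)" "finite (clocks B)" "finite (params A)" "finite (params B)"
    "finite (edges A)" "finite (edges B)"
    by (auto simp: wf_pta_def)
  have flds: "acts A = acts B" "locs A = locs B" "init A = init B" "clocks A = clocks B"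
    "params A = params B"
    and invs: "graph_code (locs A) (\<lambda>l. constr_code (invar A l)) =
      graph_code (locs A) (\<lambda>l. constr_code (invar B l))"
    and edgs: "edge_code ` edges A = edge_code ` edges B"
    and vals: "graph_code (params A) (\<lambda>p. rat_code (v p)) =
      graph_code (params A) (\<lambda>p. rat_code (w p))"
    using eq fin
    by (auto simp: instance_code_def list_encode_eq set_encode_eq simp del: list_encode.simps)
  have "invar A l = invar B l" for l
    using graph_code_eqD[OF _ invs] fin inj_eq[OF inj_constr_code] wf flds
    by (cases "l \<in> locs A") (auto simp: wf_pta_def)
  moreover have "v p = w p" for p
    using graph_code_eqD[OF _ vals] fin inj_eq[OF inj_rat_code] wf flds
    by (cases "p \<in> params A") (auto simp: pvaluations_def)
  moreover have "edges A \<subseteq> {e. finite (resets e)}" "edges B \<subseteq> {e. finite (resets e)}"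
    using wf fin by (auto simp: wf_pta_def wf_edge_def dest: finite_subset)
  then have "edges A = edges B"
    using edgs inj_on_image_eq_iff[OF inj_on_edge_code] by blast
  ultimately show "A = B \<and> v = w"
    using flds by (intro conjI pta.equality ext) auto
qed

end

theory Submission
  imports Defs
begin

text \<open>
  Suppose that a recursive function decides one of the problems. For every recursive \<open>h\<close> there is a
  register machine that loads a number \<open>t\<close> and computes \<open>h(t)\<close>, and an L/U-PTA simulates this machine
  as long as the values of the registers are below \<open>1/p\<close>, where \<open>p\<close> is the common value of its two
  parameters. Action 1 occurs iff a register overflows or the output is not 0. All other paths of
  the automaton can be taken for all parameters by waiting first, and action 2 tests that the
  lower-bound parameter does not exceed the upper-bound parameter. Hence the valuation 0 has the
  traces of all small \<open>p\<close> if \<open>h(t) = 0\<close>, and a language different from that of any other valuation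
  otherwise. The part of the automaton that does not depend on \<open>t\<close> has a code; taking this code as
  \<open>t\<close>, and \<open>h(t)\<close> as the decision about the automaton with the code computed from \<open>t\<close>, gives a
  contradiction. No universal machine is needed.
\<close>

section \<open>Computable functions\<close>

text \<open>The obstacle is that an L/U constraint cannot test \<open>x = 1 + p\<close>; it can only
  squeeze \<open>x\<close> between a lower-bound and an upper-bound parameter. The squeeze is exact
  if both have the same value, and only there does the absence of action 1 have to be shown. If the
  lower value is below the upper one, spurious runs appear, but then only the presence of action 1
  is needed, and the faithful run with the upper value as unit is still possible. If this unit is
  too large for the computation, the overflow itself produces action 1, so no bound on the unit is
  required. The valuation 0 is separated from all others because \<open>start_edge\<close> needs a
  positive upper value. The self-reference needs an automaton whose code is computable from
  \<open>t\<close> alone. Hence \<open>t\<close> enters only two guards, which compare the elapsed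
  time with \<open>t\<close>, and the sets of locations and clocks are padded to
  \<open>{..<t}\<close>.\<close>

definition computable1 :: "(nat \<Rightarrow> nat) \<Rightarrow> bool" where
  "computable1 F \<longleftrightarrow> (\<exists>f. \<forall>x. rec_eval f [x] (F x))"

definition computable2 :: "(nat \<Rightarrow> nat \<Rightarrow> nat) \<Rightarrow> bool" where
  "computable2 F \<longleftrightarrow> (\<exists>f. \<forall>x y. rec_eval f [x, y] (F x y))"

lemma rec_eval_const: "\<exists>f. \<forall>xs. rec_eval f xs k"
proof (induction k)
  case 0
  show ?case by (metis rec_eval.zero)
next
  case (Suc k)
  then obtain f where "rec_eval f xs k" for xs by blast
  then have "rec_eval (Cn S [f]) xs (Suc k)" for xs
    by (intro rec_eval.comp[of "[k]"]) (auto intro: rec_eval.succ)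
  then show ?case by blast
qed

lemma rec_eval_Cn1: "rec_eval g xs y \<Longrightarrow> rec_eval f [y] z \<Longrightarrow> rec_eval (Cn f [g]) xs z"
  by (rule rec_eval.comp[of "[y]"]) auto

lemma rec_eval_Cn2:
  "rec_eval g xs y \<Longrightarrow> rec_eval h xs z \<Longrightarrow> rec_eval f [y, z] u \<Longrightarrow> rec_eval (Cn f [g, h]) xs u"
  by (rule rec_eval.comp[of "[y, z]"]) (auto simp: less_Suc_eq)

lemma computable1_const: "computable1 (\<lambda>_. k)"
  using rec_eval_const[of k] by (auto simp: computable1_def)

lemma computable1_id: "computable1 (\<lambda>x. x)"
  using rec_eval.proj[of 0 "[_]"] by (auto simp: computable1_def)

lemma computable1_Suc: "computable1 F \<Longrightarrow> computable1 (\<lambda>x. Suc (F x))"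
  unfolding computable1_def by (blast intro: rec_eval_Cn1 rec_eval.succ)

lemma computable1_compose: "computable1 F \<Longrightarrow> computable1 G \<Longrightarrow> computable1 (\<lambda>x. F (G x))"
  unfolding computable1_def by (blast intro: rec_eval_Cn1)

lemma computable1_compose2:
  "computable2 F \<Longrightarrow> computable1 G \<Longrightarrow> computable1 H \<Longrightarrow> computable1 (\<lambda>x. F (G x) (H x))"
  unfolding computable1_def computable2_def by (blast intro: rec_eval_Cn2)

lemma computable2_compose:
  "computable1 F \<Longrightarrow> computable2 G \<Longrightarrow> computable2 (\<lambda>x y. F (G x y))"
  unfolding computable1_def computable2_def by (blast intro: rec_eval_Cn1)

lemma computable2_compose2:
  "computable2 F \<Longrightarrow> computable2 G \<Longrightarrow> computable2 H \<Longrightarrow> computable2 (\<lambda>x y. F (G x y) (H x y))"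
proof -
  assume "computable2 F" "computable2 G" "computable2 H"
  then obtain f g h where "rec_eval f [x, y] (F x y)" "rec_eval g [x, y] (G x y)"
    "rec_eval h [x, y] (H x y)" for x y
    unfolding computable2_def by metis
  then have "rec_eval (Cn f [g, h]) [x, y] (F (G x y) (H x y))" for x y
    by (intro rec_eval_Cn2)
  then show ?thesis unfolding computable2_def by blast
qed

lemma computable2_fst: "computable2 (\<lambda>x y. x)"
  and computable2_snd: "computable2 (\<lambda>x y. y)"
proof -
  have "rec_eval (Proj 0) [x, y] x" "rec_eval (Proj 1) [x, y] y" for x y
    using rec_eval.proj[of 0 "[x, y]"] rec_eval.proj[of 1 "[x, y]"] by simp_all
  then show "computable2 (\<lambda>x y. x)" "computable2 (\<lambda>x y. y)"
    unfolding computable2_def by blast+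
qed

lemma computable1_primrec:
  assumes "computable2 G" "\<And>n. F (Suc n) = G n (F n)"
  shows "computable1 F"
proof -
  obtain g where g: "rec_eval g [x, y] (G x y)" for x y
    using assms(1) by (auto simp: computable2_def)
  \<comment> \<open>The base case of \<open>Pr\<close> is evaluated on the empty argument list here,
    so a program is needed that yields \<open>F 0\<close> on every list.\<close>
  obtain k where k: "rec_eval k xs (F 0)" for xs
    using rec_eval_const by blast
  have "rec_eval (Pr k g) [n] (F n)" for n
  proof (induction n)
    case 0
    show ?case by (rule rec_eval.prim_0[OF k])
  next
    case (Suc n)
    then show ?case unfolding assms(2) by (rule rec_eval.prim_Suc[OF _ g])
  qed
  then show ?thesis by (auto simp: computable1_def)
qed

lemma computable2_add: "computable2 (+)"
proof -
  have "rec_eval (Pr (Proj 0) (Cn S [Proj 1])) [m, n] (m + n)" for m n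
  proof (induction m)
    case 0
    show ?case using rec_eval.proj[of 0 "[n]"] by (auto intro: rec_eval.prim_0)
  next
    case (Suc m)
    have "rec_eval (Cn S [Proj 1]) [m, m + n, n] (Suc (m + n))"
      using rec_eval.proj[of 1 "[m, m + n, n]"] by (auto intro: rec_eval_Cn1 rec_eval.succ)
    with Suc show ?case by (auto intro: rec_eval.prim_Suc)
  qed
  then show ?thesis by (auto simp: computable2_def)
qed

lemma computable1_add: "computable1 F \<Longrightarrow> computable1 G \<Longrightarrow> computable1 (\<lambda>x. F x + G x)"
  by (rule computable1_compose2[OF computable2_add])

lemma computable1_power2: "computable1 F \<Longrightarrow> computable1 (\<lambda>x. 2 ^ F x)"
proof (rule computable1_compose[of "\<lambda>n. 2 ^ n"])
  show "computable1 (\<lambda>n. 2 ^ n)"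
    by (rule computable1_primrec[OF computable2_compose2[OF computable2_add computable2_snd computable2_snd]])
      simp
qed

lemma computable1_triangle: "computable1 triangle"
proof (rule computable1_primrec[of "\<lambda>n y. y + Suc n"])
  have "computable1 Suc" using computable1_Suc[OF computable1_id] .
  then show "computable2 (\<lambda>n y. y + Suc n)"
    by (intro computable2_compose2[OF computable2_add] computable2_compose[of Suc]
        computable2_fst computable2_snd)
qed simp

lemma computable1_prod_encode:
  "computable1 F \<Longrightarrow> computable1 G \<Longrightarrow> computable1 (\<lambda>x. prod_encode (F x, G x))"
  unfolding prod_encode_def prod.case
  by (rule computable1_add[OF computable1_compose[OF computable1_triangle computable1_add]])

lemma computable1_list_encode_Cons:
  "computable1 F \<Longrightarrow> computable1 (\<lambda>x. list_encode (G x)) \<Longrightarrow> computable1 (\<lambda>x. list_encode (F x # G x))"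
  unfolding list_encode.simps by (rule computable1_Suc[OF computable1_prod_encode])

text \<open>\<open>set_encode\<close> adds \<open>2 ^ m\<close> for each member \<open>m\<close>,
  which is a primitive recursion as soon as injectivity makes \<open>F n\<close> a new member in
  each step.\<close>

lemma computable1_set_encode_image_lessThan:
  assumes "computable1 F" "inj F"
  shows "computable1 (\<lambda>n. set_encode (F ` {..<n}))"
proof (rule computable1_primrec[of "\<lambda>n y. y + 2 ^ F n"])
  show "computable2 (\<lambda>n y. y + 2 ^ F n)"
    by (intro computable2_compose2[OF computable2_add] computable2_snd
        computable2_compose[of "\<lambda>n. 2 ^ F n"] computable1_power2 assms computable2_fst)
  show "set_encode (F ` {..<Suc n}) = set_encode (F ` {..<n}) + 2 ^ F n" for n
    using assms(2) by (simp add: lessThan_Suc inj_image_mem_iff)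
qed

section \<open>Compilation of recursive functions\<close>

text \<open>\<open>Loop r c\<close> decrements \<open>r\<close> before each pass through
  \<open>c\<close>, which is what one \<open>DEC\<close> instruction with its two exits does. There
  is no skip; \<open>Dec\<close> of an empty register takes its place.\<close>

datatype com = Inc nat | Dec nat | Seq com com | Loop nat com

inductive exec :: "com \<Rightarrow> (nat \<Rightarrow> nat) \<Rightarrow> (nat \<Rightarrow> nat) \<Rightarrow> bool" where
  Inc: "exec (Inc r) s (s(r := Suc (s r)))"
| Dec: "exec (Dec r) s (s(r := s r - 1))"
| Seq: "exec c s s' \<Longrightarrow> exec c' s' s'' \<Longrightarrow> exec (Seq c c') s s''"
| Loop_0: "s r = 0 \<Longrightarrow> exec (Loop r c) s s"
| Loop_Suc: "s r = Suc k \<Longrightarrow> exec c (s(r := k)) s' \<Longrightarrow> exec (Loop r c) s' s'' \<Longrightarrow>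
    exec (Loop r c) s s''"

lemma exec_eq: "exec c s s' \<Longrightarrow> s' = s'' \<Longrightarrow> exec c s s''"
  by simp

definition clear :: "nat \<Rightarrow> com" where
  "clear r = Loop r (Dec r)"

lemma exec_clear: "exec (clear r) s (s(r := 0))"
proof (induction "s r" arbitrary: s rule: less_induct)
  case less
  show ?case
  proof (cases "s r")
    case 0
    then show ?thesis unfolding clear_def by (metis exec.Loop_0 fun_upd_triv)
  next
    case (Suc k)
    have "exec (clear r) (s(r := k - 1)) (s(r := 0))"
      using less[of "s(r := k - 1)"] Suc by simp
    moreover have "exec (Dec r) (s(r := k)) (s(r := k - 1))"
      using exec.Dec[of r "s(r := k)"] by simp
    ultimately show ?thesis unfolding clear_def by (metis Suc exec.Loop_Suc)
  qed
qed

definition move :: "nat \<Rightarrow> nat \<Rightarrow> com" where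
  "move a b = Loop a (Inc b)"

lemma exec_move: "a \<noteq> b \<Longrightarrow> exec (move a b) s (s(a := 0, b := s a + s b))"
proof (induction "s a" arbitrary: s)
  case 0
  then have "s(a := 0, b := s a + s b) = s" by (simp add: fun_eq_iff)
  then show ?case using 0 unfolding move_def by (metis exec.Loop_0)
next
  case (Suc k)
  let ?s = "s(a := k, b := Suc (s b))"
  have "exec (move a b) ?s (s(a := 0, b := s a + s b))"
    by (rule exec_eq[OF Suc(1)]) (use Suc(2,3) in \<open>simp_all add: fun_eq_iff\<close>)
  moreover have "exec (Inc b) (s(a := k)) ?s"
    using exec.Inc[of b "s(a := k)"] Suc(3) by simp
  ultimately show ?case unfolding move_def by (metis Suc(2) exec.Loop_Suc)
qed

definition copy :: "nat \<Rightarrow> nat \<Rightarrow> nat \<Rightarrow> com" where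
  "copy a b u = Seq (Loop a (Seq (Inc b) (Inc u))) (move u a)"

lemma exec_copy:
  assumes "a \<noteq> b" "a \<noteq> u" "b \<noteq> u" "s u = 0"
  shows "exec (copy a b u) s (s(b := s a + s b))"
proof -
  have "exec (Loop a (Seq (Inc b) (Inc u))) s (s(a := 0, b := s a + s b, u := s a + s u))" for s
  proof (induction "s a" arbitrary: s)
    case 0
    then have "s(a := 0, b := s a + s b, u := s a + s u) = s" by (simp add: fun_eq_iff)
    then show ?case using 0 by (metis exec.Loop_0)
  next
    case (Suc k)
    let ?s = "s(a := k, b := Suc (s b), u := Suc (s u))"
    have "exec (Loop a (Seq (Inc b) (Inc u))) ?s (s(a := 0, b := s a + s b, u := s a + s u))"
      by (rule exec_eq[OF Suc(1)]) (use Suc(2) assms in \<open>simp_all add: fun_eq_iff\<close>)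
    moreover have "exec (Seq (Inc b) (Inc u)) (s(a := k)) ?s"
      using assms by (intro exec.Seq[OF exec.Inc] exec_eq[OF exec.Inc]) auto
    ultimately show ?case by (metis Suc(2) exec.Loop_Suc)
  qed
  then show ?thesis unfolding copy_def
    using assms by (intro exec.Seq exec_eq[OF exec_move]) (auto simp: fun_eq_iff)
qed

fun clears :: "nat \<Rightarrow> nat \<Rightarrow> com" where
  "clears n 0 = Dec n"
| "clears n (Suc k) = Seq (clear (n + k)) (clears n k)"

text \<open>The final \<open>Dec n\<close> stands for doing nothing, so register \<open>n\<close>
  has to be 0 by then. The hypothesis ensures this if \<open>k = 0\<close>; otherwise the last
  clearing does.\<close>

lemma exec_clears: "s (n + k) = 0 \<Longrightarrow> exec (clears n k) s (\<lambda>i. if n \<le> i \<and> i < n + k then 0 else s i)"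
proof (induction k arbitrary: s)
  case 0
  then show ?case by (auto intro!: exec_eq[OF exec.Dec])
next
  case (Suc k)
  have "exec (clears n k) (s(n + k := 0))
      (\<lambda>i. if n \<le> i \<and> i < n + k then 0 else (s(n + k := 0)) i)"
    by (rule Suc.IH) simp
  then show ?case
    unfolding clears.simps
    by (intro exec.Seq[OF exec_clear]) (erule exec_eq, auto simp: fun_eq_iff)
qed

type_synonym routine = "nat list \<Rightarrow> nat \<Rightarrow> nat \<Rightarrow> com"

fun eval_args :: "routine list \<Rightarrow> nat list \<Rightarrow> nat \<Rightarrow> nat \<Rightarrow> com \<Rightarrow> com" where
  "eval_args [] ins j n c = c"
| "eval_args (F # Fs) ins j n c = Seq (F ins j n) (eval_args Fs ins (Suc j) n c)"

text \<open>\<open>compile f ins out n\<close> takes its arguments from the registers \<open>ins\<close> and uses the registers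
  from \<open>n\<close> on as workspace, which has to be 0 before and is 0 again afterwards.\<close>

primrec compile :: "recf \<Rightarrow> routine" where
  "compile Z = (\<lambda>ins out n. Dec out)"
| "compile S = (\<lambda>ins out n. Seq (copy (ins ! 0) out n) (Inc out))"
| "compile (Proj i) = (\<lambda>ins out n. copy (ins ! i) out n)"
| "compile (Cn f gs) = (\<lambda>ins out n. let k = length gs in
     eval_args (map compile gs) ins n (n + k)
       (Seq (compile f [n..<n + k] out (n + k)) (clears n k)))"
| "compile (Pr f g) = (\<lambda>ins out n.
     Seq (copy (ins ! 0) n (n + 1))
    (Seq (compile f (tl ins) (n + 2) (n + 4))
    (Seq (Loop n
       (Seq (compile g ((n + 1) # (n + 2) # tl ins) (n + 3) (n + 4))
       (Seq (clear (n + 2)) (Seq (move (n + 3) (n + 2)) (Inc (n + 1))))))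
    (Seq (move (n + 2) out) (clear (n + 1))))))"
| "compile (Mn f) = (\<lambda>ins out n.
     Seq (compile f (n # ins) (n + 1) (n + 2))
    (Seq (Loop (n + 1)
       (Seq (clear (n + 1)) (Seq (Inc n) (compile f (n # ins) (n + 1) (n + 2)))))
    (move n out)))"

text \<open>Copying and moving add to the target, so \<open>out\<close> must be 0 on entry. The
  arguments are left intact because \<open>Cn\<close>, \<open>Pr\<close> and \<open>Mn\<close> use
  them several times.\<close>

definition implements :: "routine \<Rightarrow> nat list \<Rightarrow> nat \<Rightarrow> bool" where
  "implements F xs y \<longleftrightarrow> (\<forall>s ins out n. map s ins = xs \<longrightarrow> (\<forall>i\<in>set ins. i < n) \<longrightarrow> out < n \<longrightarrow>
     out \<notin> set ins \<longrightarrow> s out = 0 \<longrightarrow> (\<forall>i\<ge>n. s i = 0) \<longrightarrow> exec (F ins out n) s (s(out := y)))"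

lemma implementsD:
  "implements F xs y \<Longrightarrow> map s ins = xs \<Longrightarrow> \<forall>i\<in>set ins. i < n \<Longrightarrow> out < n \<Longrightarrow> out \<notin> set ins \<Longrightarrow>
    s out = 0 \<Longrightarrow> \<forall>i\<ge>n. s i = 0 \<Longrightarrow> s' = s(out := y) \<Longrightarrow> exec (F ins out n) s s'"
  by (simp add: implements_def)

lemma exec_eval_args:
  assumes "length Fs = length ys" "\<forall>i<length Fs. implements (Fs ! i) xs (ys ! i)"
    "map s ins = xs" "\<forall>i\<in>set ins. i < j" "\<forall>i\<ge>j. s i = 0" "n = j + length Fs"
    "exec c (\<lambda>i. if j \<le> i \<and> i < n then ys ! (i - j) else s i) s'"
  shows "exec (eval_args Fs ins j n c) s s'"
  using assms
proof (induction Fs arbitrary: ys s j)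
  case Nil
  then have "(\<lambda>i. if j \<le> i \<and> i < n then ys ! (i - j) else s i) = s" by auto
  with Nil show ?case by simp
next
  case (Cons F Fs)
  obtain y ys' where ys: "ys = y # ys'" using Cons.prems(1) by (cases ys) auto
  have "exec (F ins j n) s (s(j := y))"
  proof (rule implementsD)
    show "implements F xs y" using Cons.prems(2) ys by force
  qed (use Cons.prems in \<open>auto simp: less_le_trans\<close>)
  moreover have "exec (eval_args Fs ins (Suc j) n c) (s(j := y)) s'"
  proof (rule Cons.IH[of ys'])
    show "\<forall>i<length Fs. implements (Fs ! i) xs (ys' ! i)"
      using Cons.prems(2) ys by force
    show "map (s(j := y)) ins = xs" using Cons.prems(3,4) by (auto simp: map_fun_upd)
    have "(\<lambda>i. if Suc j \<le> i \<and> i < n then ys' ! (i - Suc j) else (s(j := y)) i) =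
        (\<lambda>i. if j \<le> i \<and> i < n then ys ! (i - j) else s i)"
      using Cons.prems(6) by (auto simp: ys fun_eq_iff nth_Cons' Suc_diff_le)
    then show "exec c (\<lambda>i. if Suc j \<le> i \<and> i < n then ys' ! (i - Suc j) else (s(j := y)) i) s'"
      using Cons.prems(7) by simp
  qed (use Cons.prems ys in auto)
  ultimately show ?case by (auto intro: exec.Seq)
qed

inductive_cases rec_eval_Z: "rec_eval Z xs y"
inductive_cases rec_eval_S: "rec_eval S xs y"
inductive_cases rec_eval_Proj: "rec_eval (Proj i) xs y"
inductive_cases rec_eval_Cn: "rec_eval (Cn f gs) xs y"
inductive_cases rec_eval_Pr: "rec_eval (Pr f g) xs y"
inductive_cases rec_eval_Mn: "rec_eval (Mn f) xs y"

text \<open>Unrolling the recursion into the table \<open>Y\<close> of its intermediate values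
  provides the invariant of the compiled loop.\<close>

lemma rec_eval_Pr_values:
  "rec_eval (Pr f g) (m # xs) y \<Longrightarrow> \<exists>Y. rec_eval f xs (Y 0) \<and> Y m = y \<and>
     (\<forall>i<m. rec_eval g (i # Y i # xs) (Y (Suc i)))"
proof (induction m arbitrary: y)
  case 0
  then show ?case by (auto elim: rec_eval_Pr intro: exI[of _ "\<lambda>_. y"])
next
  case (Suc m)
  then obtain y' where y': "rec_eval (Pr f g) (m # xs) y'" "rec_eval g (m # y' # xs) y"
    by (auto elim: rec_eval_Pr)
  then obtain Y where "rec_eval f xs (Y 0)" "Y m = y'"
    "\<forall>i<m. rec_eval g (i # Y i # xs) (Y (Suc i))" using Suc.IH by blast
  then show ?case using y' by (intro exI[of _ "Y(Suc m := y)"]) (auto simp: less_Suc_eq)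
qed

lemma implements_compile: "rec_eval f xs y \<Longrightarrow> implements (compile f) xs y"
proof (induction f arbitrary: xs y)
  case Z
  then show ?case
    by (auto simp: implements_def elim!: rec_eval_Z intro: exec_eq[OF exec.Dec])
next
  case S
  then obtain x xs' where x: "xs = x # xs'" "y = Suc x" by (auto elim: rec_eval_S)
  show ?case unfolding implements_def
  proof (intro allI impI)
    fix s :: "nat \<Rightarrow> nat" and ins out n
    assume a: "map s ins = xs" "\<forall>i\<in>set ins. i < n" "out < n" "out \<notin> set ins" "s out = 0" "\<forall>i\<ge>n. s i = 0"
    obtain i ins' where i: "ins = i # ins'" using a x by auto
    show "exec (compile S ins out n) s (s(out := y))"
      using a i x by (auto intro!: exec.Seq[OF exec_copy] exec_eq[OF exec.Inc])
  qed
next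
  case (Proj i)
  then have x: "i < length xs" "y = xs ! i" by (auto elim: rec_eval_Proj)
  show ?case unfolding implements_def
  proof (intro allI impI)
    fix s :: "nat \<Rightarrow> nat" and ins out n
    assume a: "map s ins = xs" "\<forall>i\<in>set ins. i < n" "out < n" "out \<notin> set ins" "s out = 0" "\<forall>i\<ge>n. s i = 0"
    then have "ins ! i \<in> set ins" using x by auto
    then have "ins ! i < n" "ins ! i \<noteq> out" using a by auto
    then show "exec (compile (Proj i) ins out n) s (s(out := y))"
      using a x by (auto intro!: exec_eq[OF exec_copy])
  qed
next
  case (Cn f gs)
  from Cn.prems obtain ys where ys: "length ys = length gs"
    "\<forall>i<length gs. rec_eval (gs ! i) xs (ys ! i)" "rec_eval f ys y"
    by (auto elim: rec_eval_Cn)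
  show ?case unfolding implements_def
  proof (intro allI impI)
    fix s :: "nat \<Rightarrow> nat" and ins out n
    assume a: "map s ins = xs" "\<forall>i\<in>set ins. i < n" "out < n" "out \<notin> set ins" "s out = 0" "\<forall>i\<ge>n. s i = 0"
    let ?k = "length gs"
    let ?s = "\<lambda>i. if n \<le> i \<and> i < n + ?k then ys ! (i - n) else s i"
    have "exec (compile f [n..<n + ?k] out (n + ?k)) ?s (?s(out := y))"
      by (rule implementsD[OF Cn.IH(1)[OF ys(3)]])
        (use a ys in \<open>auto intro!: nth_equalityI\<close>)
    moreover have "exec (clears n ?k) (?s(out := y)) (s(out := y))"
      using a by (intro exec_eq[OF exec_clears]) (auto simp: fun_eq_iff)
    ultimately have "exec (Seq (compile f [n..<n + ?k] out (n + ?k)) (clears n ?k)) ?s (s(out := y))"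
      by (rule exec.Seq)
    then show "exec (compile (Cn f gs) ins out n) s (s(out := y))"
      unfolding compile.simps Let_def
      by (intro exec_eval_args[of _ ys xs]) (use a ys Cn.IH(2) in auto)
  qed
next
  case (Pr f g)
  from Pr.prems obtain m xs' where xs: "xs = m # xs'" by (auto elim: rec_eval_Pr)
  obtain Y where Y: "rec_eval f xs' (Y 0)" "Y m = y"
    "\<forall>i<m. rec_eval g (i # Y i # xs') (Y (Suc i))"
    using rec_eval_Pr_values Pr.prems xs by blast
  show ?case unfolding implements_def
  proof (intro allI impI)
    fix s :: "nat \<Rightarrow> nat" and ins out n
    assume a: "map s ins = xs" "\<forall>i\<in>set ins. i < n" "out < n" "out \<notin> set ins" "s out = 0" "\<forall>i\<ge>n. s i = 0"
    obtain r ins' where ins: "ins = r # ins'" "s r = m" "map s ins' = xs'" using a xs by auto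
    have fresh: "n \<notin> set ins'" "Suc n \<notin> set ins'" "Suc (Suc n) \<notin> set ins'"
      using a(2) ins by auto
    let ?body = "Seq (compile g ((n + 1) # (n + 2) # tl ins) (n + 3) (n + 4))
       (Seq (clear (n + 2)) (Seq (move (n + 3) (n + 2)) (Inc (n + 1))))"
    \<comment> \<open>Loop invariant: register \<open>n\<close> holds the number of rounds left,
      \<open>n + 1\<close> the argument reached so far, and \<open>n + 2\<close> the value of the
      recursion there.\<close>
    let ?s = "\<lambda>k i. s(n := k, n + 1 := i, n + 2 := Y i)"
    have loop: "exec (Loop n ?body) (?s k i) (?s 0 m)" if "k + i = m" for k i
      using that
    proof (induction k arbitrary: i)
      case 0
      then show ?case by (auto intro: exec.Loop_0)
    next
      case (Suc k)
      have "exec (compile g ((n + 1) # (n + 2) # tl ins) (n + 3) (n + 4)) (?s k i)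
          ((?s k i)(n + 3 := Y (Suc i)))"
      proof (rule implementsD)
        show "implements (compile g) (i # Y i # xs') (Y (Suc i))"
          using Y(3) Suc.prems by (intro Pr.IH(2)) auto
      qed (use a ins fresh in \<open>auto simp: map_fun_upd\<close>)
      moreover have "exec (Seq (clear (n + 2)) (Seq (move (n + 3) (n + 2)) (Inc (n + 1))))
          ((?s k i)(n + 3 := Y (Suc i))) (?s k (Suc i))"
        by (intro exec.Seq[OF exec_clear] exec.Seq[OF exec_move] exec_eq[OF exec.Inc])
          (use a in \<open>auto simp: fun_eq_iff\<close>)
      ultimately have "exec ?body ((?s (Suc k) i)(n := k)) (?s k (Suc i))"
        by (auto intro: exec.Seq simp: fun_upd_twist)
      moreover have "exec (Loop n ?body) (?s k (Suc i)) (?s 0 m)"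
        by (rule Suc.IH) (use Suc.prems in simp)
      ultimately show ?case
        by (rule exec.Loop_Suc[rotated 1]) simp
    qed
    have "exec (copy (ins ! 0) n (n + 1)) s (s(n := m))"
      using a ins by (intro exec_eq[OF exec_copy]) auto
    moreover have "exec (compile f (tl ins) (n + 2) (n + 4)) (s(n := m)) (?s m 0)"
    proof (rule implementsD[OF Pr.IH(1)[OF Y(1)]])
    qed (use a ins fresh in \<open>auto simp: map_fun_upd fun_eq_iff\<close>)
    moreover have "exec (Loop n ?body) (?s m 0) (?s 0 m)"
      by (rule loop) simp
    moreover have "exec (Seq (move (n + 2) out) (clear (n + 1))) (?s 0 m) (s(out := y))"
      using a Y(2) by (intro exec.Seq[OF exec_move] exec_eq[OF exec_clear]) (auto simp: fun_eq_iff)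
    ultimately show "exec (compile (Pr f g) ins out n) s (s(out := y))"
      unfolding compile.simps by (meson exec.Seq)
  qed
next
  case (Mn f)
  from Mn.prems have y: "rec_eval f (y # xs) 0" "\<forall>m<y. \<exists>k. rec_eval f (m # xs) (Suc k)"
    by (auto elim: rec_eval_Mn)
  \<comment> \<open>\<open>V m\<close> is the value of \<open>f\<close> at the candidate
    \<open>m\<close>. It vanishes exactly at \<open>y\<close>, so the loop on register
    \<open>n + 1\<close> stops there.\<close>
  then obtain V where V: "rec_eval f (m # xs) (V m)" "(V m = 0) = (m = y)" if "m \<le> y" for m
  proof -
    have "\<exists>v. m \<le> y \<longrightarrow> rec_eval f (m # xs) v \<and> (v = 0) = (m = y)" for m
      using y by (cases "m < y"; cases "m = y") auto
    then show ?thesis using that by metis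
  qed
  show ?case unfolding implements_def
  proof (intro allI impI)
    fix s :: "nat \<Rightarrow> nat" and ins out n
    assume a: "map s ins = xs" "\<forall>i\<in>set ins. i < n" "out < n" "out \<notin> set ins" "s out = 0" "\<forall>i\<ge>n. s i = 0"
    let ?f = "compile f (n # ins) (n + 1) (n + 2)"
    let ?body = "Seq (clear (n + 1)) (Seq (Inc n) ?f)"
    have step: "exec ?f (s(n := m)) (s(n := m, n + 1 := V m))" if "m \<le> y" for m
    proof (rule implementsD[OF Mn.IH[OF V(1)[OF that]]])
    qed (use a in \<open>auto simp: map_fun_upd\<close>)
    have loop: "exec (Loop (n + 1) ?body) (s(n := m, n + 1 := V m)) (s(n := y))" if "k + m = y" for k m
      using that
    proof (induction k arbitrary: m)
      case 0
      then show ?case using V[of m] a by (intro exec_eq[OF exec.Loop_0]) (auto simp: fun_eq_iff)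
    next
      case (Suc k)
      then obtain v where v: "V m = Suc v" using V(2)[of m] by (cases "V m") auto
      have "exec ?body ((s(n := m, n + 1 := V m))(n + 1 := v)) (s(n := Suc m, n + 1 := V (Suc m)))"
      proof (rule exec.Seq[OF exec_clear], rule exec.Seq[OF exec.Inc])
        let ?u = "(s(n := m, n + 1 := V m))(n + 1 := v, n + 1 := 0)"
        have "?u(n := Suc (?u n)) = s(n := Suc m)"
          using a by (auto simp: fun_eq_iff)
        then show "exec ?f (?u(n := Suc (?u n))) (s(n := Suc m, n + 1 := V (Suc m)))"
          using step[of "Suc m"] Suc.prems by simp
      qed
      moreover have "exec (Loop (n + 1) ?body) (s(n := Suc m, n + 1 := V (Suc m))) (s(n := y))"
        by (rule Suc.IH) (use Suc.prems in simp)
      ultimately show ?case by (rule exec.Loop_Suc[rotated 1]) (simp add: v)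
    qed
    have "exec ?f s (s(n := 0, n + 1 := V 0))"
      using step[of 0] a by (simp add: fun_upd_idem)
    moreover have "exec (Loop (n + 1) ?body) (s(n := 0, n + 1 := V 0)) (s(n := y))"
      by (rule loop[of y]) simp
    moreover have "exec (move n out) (s(n := y)) (s(out := y))"
      using a by (intro exec_eq[OF exec_move]) (auto simp: fun_eq_iff)
    ultimately show "exec (compile (Mn f) ins out n) s (s(out := y))"
      unfolding compile.simps by (meson exec.Seq)
  qed
qed

section \<open>Register machines\<close>

datatype instr = INC nat nat | DEC nat nat nat

fun com_size :: "com \<Rightarrow> nat" where
  "com_size (Inc r) = 1"
| "com_size (Dec r) = 1"
| "com_size (Seq c c') = com_size c + com_size c'"
| "com_size (Loop r c) = Suc (com_size c)"

text \<open>\<open>flatten c l l'\<close> is entered at label \<open>l\<close> and left towards label \<open>l'\<close>.\<close>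

fun flatten :: "com \<Rightarrow> nat \<Rightarrow> nat \<Rightarrow> (nat \<times> instr) list" where
  "flatten (Inc r) l l' = [(l, INC r l')]"
| "flatten (Dec r) l l' = [(l, DEC r l' l')]"
| "flatten (Seq c c') l l' = flatten c l (l + com_size c) @ flatten c' (l + com_size c) l'"
| "flatten (Loop r c) l l' = (l, DEC r (Suc l) l') # flatten c (Suc l) l"

text \<open>At label 2, the value \<open>t\<close> is loaded into register 0 by means of the instruction
  \<open>(5, INC 0 2)\<close>; label 6 is the entry of the program.\<close>

inductive mstep ::
  "(nat \<times> instr) set \<Rightarrow> nat \<Rightarrow> nat \<times> (nat \<Rightarrow> nat) \<Rightarrow> nat \<times> (nat \<Rightarrow> nat) \<Rightarrow> bool"
  for P t where
  inc: "(l, INC r l') \<in> P \<Longrightarrow> mstep P t (l, c) (l', c(r := Suc (c r)))"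
| dec: "(l, DEC r l' l'') \<in> P \<Longrightarrow> c r = Suc k \<Longrightarrow> mstep P t (l, c) (l', c(r := k))"
| zero: "(l, DEC r l' l'') \<in> P \<Longrightarrow> c r = 0 \<Longrightarrow> mstep P t (l, c) (l'', c)"
| load: "c 0 < t \<Longrightarrow> mstep P t (2, c) (5, c)"
| loaded: "c 0 = t \<Longrightarrow> mstep P t (2, c) (6, c)"

lemma com_size_pos: "0 < com_size c"
  by (induction c) auto

lemma map_fst_flatten: "map fst (flatten c l l') = [l..<l + com_size c]"
proof (induction c arbitrary: l l')
  case (Seq c c')
  then show ?case using upt_add_eq_append[of l "l + com_size c" "com_size c'"] by (simp add: ac_simps)
qed (simp_all add: upt_conv_Cons)

lemma flatten_functional:
  "(m, I) \<in> set (flatten c l l') \<Longrightarrow> (m, I') \<in> set (flatten c l l') \<Longrightarrow> I = I'"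
  using map_fst_flatten[of c l l'] eq_key_imp_eq_value distinct_upt by metis

lemma flatten_label: "(m, I) \<in> set (flatten c l l') \<Longrightarrow> l \<le> m \<and> m < l + com_size c"
  by (metis atLeastLessThan_iff map_fst_flatten fst_conv image_eqI list.set_map set_upt)

fun targets :: "instr \<Rightarrow> nat set" where
  "targets (INC r l) = {l}"
| "targets (DEC r l l') = {l, l'}"

lemma flatten_targets:
  "(m, I) \<in> set (flatten c l l') \<Longrightarrow> k \<in> targets I \<Longrightarrow> k = l' \<or> l \<le> k \<and> k < l + com_size c"
proof (induction c arbitrary: l l')
  case (Seq c c')
  then show ?case using com_size_pos[of c'] by fastforce
next
  case (Loop r c)
  then show ?case using com_size_pos[of c] by fastforce
qed auto

lemma exec_imp_msteps:
  "exec c s s' \<Longrightarrow> set (flatten c l l') \<subseteq> P \<Longrightarrow> (mstep P t)\<^sup>*\<^sup>* (l, s) (l', s')"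
proof (induction arbitrary: l l' rule: exec.induct)
  case (Inc r s)
  then show ?case by (intro r_into_rtranclp mstep.inc) simp
next
  case (Dec r s)
  show ?case
  proof (cases "s r")
    case 0
    with Dec have "mstep P t (l, s) (l', s)" by (auto intro: mstep.zero)
    moreover have "s(r := s r - 1) = s" using 0 by auto
    ultimately show ?thesis by simp
  next
    case (Suc k)
    have "mstep P t (l, s) (l', s(r := k))" using Dec Suc by (intro mstep.dec) auto
    then show ?thesis using Suc by (metis diff_Suc_1 r_into_rtranclp)
  qed
next
  case (Seq c s s' c' s'')
  then show ?case by simp (meson rtranclp_trans)
next
  case (Loop_0 s r c)
  then show ?case by (intro r_into_rtranclp mstep.zero) auto
next
  case (Loop_Suc s r k c s' s'')
  then have "mstep P t (l, s) (Suc l, s(r := k))" by (intro mstep.dec) auto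
  also have "(mstep P t)\<^sup>*\<^sup>* (Suc l, s(r := k)) (l, s')"
    by (rule Loop_Suc.IH(1)) (use Loop_Suc.prems in simp)
  also have "(mstep P t)\<^sup>*\<^sup>* (l, s') (l', s'')" using Loop_Suc by blast
  finally show ?case .
qed

text \<open>Under determinism, everything reachable from \<open>a\<close> lies on the single finite
  chain that ends in \<open>b\<close>. Finiteness will bound the registers; the second part makes
  the halting configuration unique.\<close>

lemma deterministic_reachable:
  assumes det: "\<And>x y z. R x y \<Longrightarrow> R x z \<Longrightarrow> y = z" and stuck: "\<And>x. \<not> R b x"
    and "R\<^sup>*\<^sup>* a b"
  shows "finite {x. R\<^sup>*\<^sup>* a x} \<and> (\<forall>x. R\<^sup>*\<^sup>* a x \<longrightarrow> R\<^sup>*\<^sup>* x b)"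
  using assms(3)
proof (induction rule: converse_rtranclp_induct)
  case base
  have "x = b" if "R\<^sup>*\<^sup>* b x" for x
    using that by (cases rule: converse_rtranclpE) (use stuck in auto)
  then have "{x. R\<^sup>*\<^sup>* b x} = {b}" by auto
  then show ?case by auto
next
  case (step a a')
  have *: "x = a \<or> R\<^sup>*\<^sup>* a' x" if "R\<^sup>*\<^sup>* a x" for x
    using that
  proof (cases rule: converse_rtranclpE)
    case (step y)
    then show ?thesis using det[OF \<open>R a a'\<close> \<open>R a y\<close>] by simp
  qed simp
  then have "{x. R\<^sup>*\<^sup>* a x} \<subseteq> insert a {x. R\<^sup>*\<^sup>* a' x}" by blast
  then have "finite {x. R\<^sup>*\<^sup>* a x}" using step.IH finite_subset by blast
  moreover have "R\<^sup>*\<^sup>* a b" using step.hyps by (rule converse_rtranclp_into_rtranclp)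
  ultimately show ?case using step.IH * by blast
qed

section \<open>The simulating automaton\<close>

fun param_reset :: "instr \<Rightarrow> nat \<Rightarrow> bool" where
  "param_reset (INC r l) j \<longleftrightarrow> j = r"
| "param_reset (DEC r l l') j \<longleftrightarrow> j \<noteq> r"

fun param_length :: "instr \<Rightarrow> bool" where
  "param_length (INC r l) \<longleftrightarrow> False"
| "param_length (DEC r l l') \<longleftrightarrow> True"

fun next_label :: "instr \<Rightarrow> nat" where
  "next_label (INC r l) = l"
| "next_label (DEC r l l') = l"

text \<open>A register \<open>j\<close> with value \<open>c\<close> is encoded by \<open>x = 1 - c p\<close> at the start of a cycle of length
  \<open>L\<close>. If \<open>x\<close> is reset in the cycle when \<open>x = B\<close>, then it ends with \<open>x = 1 - c p + L - B\<close>. So with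
  \<open>L, B \<in> {1, 1 + p}\<close>, selected by \<open>param_length\<close> and \<open>param_reset\<close>, one can increment and decrement.

  With parameter 0 for the lower and parameter 1 for the upper bounds, these atoms express
  \<open>x = 1 + p\<close> and \<open>x < 1 + p\<close> if \<open>b\<close>, and \<open>x = 1\<close> and \<open>x < 1\<close> otherwise.\<close>

definition at_bound :: "clock \<Rightarrow> bool \<Rightarrow> constr" where
  "at_bound x b = (if b then [ClockParam x Ge 0 1, ClockParam x Le 1 1] else [ClockConst x Eq 1])"

definition below_bound :: "clock \<Rightarrow> bool \<Rightarrow> constr" where
  "below_bound x b = (if b then [ClockParam x Lt 1 1] else [ClockConst x Lt 1])"

definition in_range :: "nat \<Rightarrow> constr" where
  "in_range K = concat (map (\<lambda>j. [ClockConst (j + 2) Gt 0, ClockConst (j + 2) Le 1]) [0..<K])"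

text \<open>Clock 0 measures the time in a cycle, clock 1 the total time since label 2 was first entered,
  and clock \<open>j + 2\<close> belongs to register \<open>j\<close>.\<close>

definition turn_edge :: "loc \<Rightarrow> instr \<Rightarrow> nat \<Rightarrow> edge" where
  "turn_edge l I j = Edge l (at_bound (j + 2) (param_reset I j) @ below_bound 0 (param_reset I j))
     0 {j + 2} l"

definition end_edge :: "nat \<Rightarrow> loc \<Rightarrow> instr \<Rightarrow> edge" where
  "end_edge K l I = Edge l (at_bound 0 (param_length I) @ in_range K) 0 {0} (next_label I)"

text \<open>When clock 0 is 0, a positive register clock has not been reset in this cycle and still
  equals \<open>1 - c p\<close>. For \<open>INC\<close>, the guard \<open>1 - c p \<le> p\<close>
  says that the incremented value would not fit. For \<open>DEC\<close>, the value 1 says that the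
  register is 0, and the range test keeps a clock that has just been reset from entering the next
  cycle.\<close>

fun special_edge :: "nat \<Rightarrow> loc \<Rightarrow> instr \<Rightarrow> edge" where
  "special_edge K l (INC r l') =
     Edge l [ClockConst 0 Eq 0, ClockConst (r + 2) Gt 0, ClockParam (r + 2) Le 1 0] 1 {} 3"
| "special_edge K l (DEC r l' l'') =
     Edge l (ClockConst 0 Eq 0 # ClockConst (r + 2) Eq 1 # in_range K) 0 {} l''"

definition skip_edge :: "loc \<Rightarrow> loc \<Rightarrow> edge" where
  "skip_edge l l' = Edge l [ClockParam 0 Gt 0 1] 0 {} l'"

definition start_edge :: edge where
  "start_edge = Edge 0 [ClockConst 0 Gt 0, ClockParam 0 Le 1 0] 0 {} 1"

text \<open>On arrival by \<open>start_edge\<close> all clocks agree. The register clocks keep the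
  value 1, which encodes 0, and the two timers restart.\<close>

definition unit_edge :: edge where
  "unit_edge = Edge 1 [ClockConst 0 Eq 1] 0 {0, 1} 2"

definition compare_edge :: edge where
  "compare_edge = Edge 0 [ClockParam 0 Ge 0 0, ClockParam 0 Le 1 0] 2 {} 3"

text \<open>Location 4 is the exit of the program, and clock 3 belongs to register 1, the output; a
  value below 1 means that this register is not 0.\<close>

definition output_edge :: edge where
  "output_edge = Edge 4 [ClockConst 0 Eq 0, ClockConst 3 Gt 0, ClockConst 3 Lt 1] 1 {} 3"

text \<open>The increment at label 5 takes a cycle of length 1, so during loading clock 1 shows the
  content of register 0. Thus \<open>t\<close> is needed only as a constant in guards and not as a
  block of instructions.\<close>

definition load_edge :: "nat \<Rightarrow> edge" where
  "load_edge t = Edge 2 [ClockConst 1 Lt (int t), ClockConst 0 Eq 0] 0 {} 5"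

definition loaded_edge :: "nat \<Rightarrow> edge" where
  "loaded_edge t = Edge 2 [ClockConst 1 Eq (int t), ClockConst 0 Eq 0] 0 {} 6"

definition base_edges :: "(nat \<times> instr) set \<Rightarrow> nat \<Rightarrow> nat \<Rightarrow> edge set" where
  "base_edges P K M = (\<lambda>((l, I), j). turn_edge l I j) ` (P \<times> {..<K})
     \<union> (\<lambda>(l, I). end_edge K l I) ` P \<union> (\<lambda>(l, I). special_edge K l I) ` P
     \<union> (\<lambda>(l, l'). skip_edge l l') ` ({..<M} \<times> {0<..<M})
     \<union> {start_edge, unit_edge, compare_edge, output_edge}"

text \<open>All locations and clocks in use are below \<open>M\<close>, whereas \<open>N\<close> is
  padding: it will be set to \<open>t\<close>, so that the codes of these sets depend on
  \<open>t\<close> alone.\<close>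

definition counter_pta :: "(nat \<times> instr) set \<Rightarrow> nat \<Rightarrow> nat \<Rightarrow> nat \<Rightarrow> nat \<Rightarrow> pta" where
  "counter_pta P K M N t = \<lparr>acts = {0, 1, 2}, locs = {..<N}, init = 0, clocks = {..<N},
     params = {0, 1}, invar = (\<lambda>_. []),
     edges = insert (load_edge t) (insert (loaded_edge t) (base_edges P K M))\<rparr>"

lemmas edge_defs = turn_edge_def end_edge_def skip_edge_def start_edge_def unit_edge_def
  compare_edge_def output_edge_def load_edge_def loaded_edge_def

lemma sat_simps [simp]:
  "sat v w []"
  "sat v w (a # g) \<longleftrightarrow> sat_atom v w a \<and> sat v w g"
  "sat v w (g @ g') \<longleftrightarrow> sat v w g \<and> sat v w g'"
  by (simp_all add: sat_def)

lemma sat_at_bound [simp]: "sat v w (at_bound x b) \<longleftrightarrow>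
    (if b then of_rat (v 0) + 1 \<le> w x \<and> w x \<le> of_rat (v 1) + 1 else w x = 1)"
  by (simp add: at_bound_def)

lemma sat_below_bound [simp]: "sat v w (below_bound x b) \<longleftrightarrow>
    (if b then w x < of_rat (v 1) + 1 else w x < 1)"
  by (simp add: below_bound_def)

lemma sat_in_range [simp]:
  "sat v w (in_range K) \<longleftrightarrow> (\<forall>j<K. 0 < w (j + 2) \<and> w (j + 2) \<le> 1)"
  by (auto simp: sat_def in_range_def list_all_iff)

lemma delay_apply [simp]: "delay w d x = w x + d"
  by (simp add: delay_def)

lemma reset_apply [simp]: "reset R w x = (if x \<in> R then 0 else w x)"
  by (simp add: reset_def)

lemma reset_empty [simp]: "reset {} w = w"
  by (simp add: reset_def)

section \<open>Machines with reserved labels below 6\<close>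

locale machine =
  fixes P :: "(nat \<times> instr) set" and K M :: nat
  assumes finite_P: "finite P"
    and functional: "(l, I) \<in> P \<Longrightarrow> (l, I') \<in> P \<Longrightarrow> I = I'"
    and load_instr: "(5, INC 0 2) \<in> P"
    and INC_bounds: "(l, INC r l') \<in> P \<Longrightarrow>
      l = 5 \<and> r = 0 \<and> l' = 2 \<or> 6 \<le> l \<and> l < M \<and> r < K \<and> l' < M \<and> (l' = 4 \<or> 6 \<le> l')"
    and DEC_bounds: "(l, DEC r l' l'') \<in> P \<Longrightarrow> 6 \<le> l \<and> l < M \<and> r < K \<and>
      l' < M \<and> (l' = 4 \<or> 6 \<le> l') \<and> l'' < M \<and> (l'' = 4 \<or> 6 \<le> l'')"
    and K_ge: "2 \<le> K" and M_ge: "7 \<le> M" "K + 2 \<le> M"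
begin

lemma label_bounds: "(l, I) \<in> P \<Longrightarrow> 5 \<le> l \<and> l < M"
  using INC_bounds DEC_bounds M_ge by (cases I) fastforce+

lemma next_label_bounds: "(l, I) \<in> P \<Longrightarrow> 0 < next_label I \<and> next_label I < M"
  using INC_bounds DEC_bounds M_ge by (cases I) fastforce+

text \<open>These are the steps without action 1. Location 0 is never entered again, so action 2 can
  only come first.\<close>

definition step_graph :: "(nat \<times> nat \<times> nat) set" where
  "step_graph = {(l, 0, l') | l l'. l < M \<and> 0 < l' \<and> l' < M} \<union> {(0, 2, 3)}"

lemma mstep_deterministic: "mstep P t a b \<Longrightarrow> mstep P t a b' \<Longrightarrow> b = b'"
  by (auto elim!: mstep.cases dest: functional label_bounds)

lemma reachable_label:
  assumes "(mstep P t)\<^sup>*\<^sup>* (2, c) (l, c')"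
  shows "2 \<le> l"
proof -
  have step: "2 \<le> fst b" if "mstep P t a b" for a b
    using that by cases (use INC_bounds DEC_bounds in fastforce)+
  have "2 \<le> fst b" if "(mstep P t)\<^sup>*\<^sup>* (2, c) b" for b
    using that by (induction rule: rtranclp_induct) (auto dest: step)
  from this[OF assms] show ?thesis by simp
qed

lemma mstep_stuck: "\<not> mstep P t (4, c) b"
  by (auto elim!: mstep.cases dest: label_bounds)

end

section \<open>Soundness of the simulation for equal parameters\<close>

locale machine_pta = machine +
  fixes N t :: nat
  assumes N_ge: "M \<le> N"
begin

abbreviation A where "A \<equiv> counter_pta P K M N t"

text \<open>Only differences to clock 0 occur, so delays preserve this. The first case is a register
  clock not yet reset in the current cycle, the second one that was reset at its bound. Clock 1
  matters only while the input is loaded.\<close>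

definition registers_ok :: "real \<Rightarrow> nat \<Rightarrow> (nat \<Rightarrow> nat) \<Rightarrow> cvaluation \<Rightarrow> bool" where
  "registers_ok q l c w \<longleftrightarrow>
     (\<forall>j<K. w (j + 2) - w 0 = 1 - c j * q \<or>
        (\<exists>I. (l, I) \<in> P \<and> w (j + 2) - w 0 = - (c j * q) - (if param_reset I j then q else 0)))
     \<and> (l = 2 \<or> l = 5 \<longrightarrow> w 1 - w 0 = c 0)"

text \<open>A state in which clock 0 exceeds \<open>1 + q\<close> has left the simulation for good, as only the
  edges \<open>skip_edge\<close> remain enabled.\<close>

definition invariant :: "real \<Rightarrow> state \<Rightarrow> bool" where
  "invariant q s \<longleftrightarrow> (let l = fst s; w = snd s in
     1 + q < w 0 \<or> l = 3 \<or> l \<le> 1 \<and> (\<forall>x. w x = w 0) \<and> (l = 1 \<longrightarrow> 0 < q) \<or>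
     0 < q \<and> (\<exists>c. (mstep P t)\<^sup>*\<^sup>* (2, \<lambda>_. 0) (l, c) \<and> registers_ok q l c w))"

text \<open>Room for one more increment, \<open>(c j + 1) q < 1\<close>, is the negation of the
  overflow guard. Nothing is demanded for \<open>q = 0\<close>, because the simulation cannot start
  then.\<close>

definition safe :: "real \<Rightarrow> bool" where
  "safe q \<longleftrightarrow> (0 < q \<longrightarrow> (\<forall>l c. (mstep P t)\<^sup>*\<^sup>* (2, \<lambda>_. 0) (l, c) \<longrightarrow>
     (\<forall>j<K. (real (c j) + 1) * q < 1) \<and> (l = 4 \<longrightarrow> c 1 = 0)))"

lemma registers_ok_delay: "registers_ok q l c w \<Longrightarrow> registers_ok q l c (delay w d)"
  by (simp add: registers_ok_def)

text \<open>After a reset in this cycle, a register clock is at most clock 0, which the guard keeps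
  strictly below the bound. So no register clock reaches its bound twice in a cycle.\<close>

lemma turn_sound:
  assumes I: "(l, I) \<in> P" and ok: "registers_ok q l c w" and q: "0 < q"
    and j: "j < K" "w (j + 2) = (if param_reset I j then q + 1 else 1)"
    "w 0 < (if param_reset I j then q + 1 else 1)"
  shows "registers_ok q l c (reset {j + 2} w)"
proof -
  have "w (j + 2) - w 0 \<noteq> - (c j * q) - (if param_reset I' j then q else 0)" if "(l, I') \<in> P" for I'
  proof -
    have "I' = I" using functional I that by blast
    moreover have "0 \<le> c j * q" using q by simp
    ultimately show ?thesis using j q by (smt (verit))
  qed
  then have "w (j + 2) - w 0 = 1 - c j * q" using ok j(1) by (auto simp: registers_ok_def)
  then have "- w 0 = - (c j * q) - (if param_reset I j then q else 0)" using j by (auto split: if_splits)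
  then show ?thesis using ok I unfolding registers_ok_def by auto
qed

text \<open>The range test forces every register clock to have been reset, since otherwise it would
  show at least \<open>2 - c q\<close>, which exceeds 1. For \<open>DEC\<close> it also forces the
  register to be positive, since its final clock value \<open>1 + q - c q\<close> must not exceed
  1.\<close>

lemma end_sound:
  assumes I: "(l, I) \<in> P" and ok: "registers_ok q l c w" and q: "0 < q"
    and z: "w 0 = (if param_length I then q + 1 else 1)"
    and range: "\<forall>j<K. 0 < w (j + 2) \<and> w (j + 2) \<le> 1"
    and small: "\<forall>j<K. (real (c j) + 1) * q < 1"
  shows "\<exists>c'. mstep P t (l, c) (next_label I, c') \<and> registers_ok q (next_label I) c' (reset {0} w)"
proof -
  have x: "w (j + 2) = (if param_length I then q + 1 else 1) - (c j * q) - (if param_reset I j then q else 0)"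
    if j: "j < K" for j
  proof -
    have "c j * q + q < 1" using small j by (simp add: algebra_simps)
    then have "w (j + 2) - w 0 \<noteq> 1 - c j * q" using j q range z by (auto split: if_splits)
    then obtain I' where "(l, I') \<in> P" "w (j + 2) - w 0 = - (c j * q) - (if param_reset I' j then q else 0)"
      using ok j by (auto simp: registers_ok_def)
    then show ?thesis using functional[OF I] z by auto
  qed
  show ?thesis
  proof (cases I)
    case (INC r l')
    have "registers_ok q l' (c(r := Suc (c r))) (reset {0} w)"
      unfolding registers_ok_def
    proof (intro conjI allI impI disjI1)
      fix j assume "j < K"
      then show "reset {0} w (j + 2) - reset {0} w 0 = 1 - real ((c(r := Suc (c r))) j) * q"
        using x[of j] INC by (auto simp: algebra_simps)
    next
      assume "l' = 2 \<or> l' = 5"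
      then have "l = 5" "r = 0" using INC_bounds I INC by fastforce+
      then show "reset {0} w 1 - reset {0} w 0 = real ((c(r := Suc (c r))) 0)"
        using ok z INC by (simp add: registers_ok_def)
    qed
    then show ?thesis using I INC by (auto intro: mstep.inc)
  next
    case (DEC r l' l'')
    have "r < K" using DEC_bounds I DEC by blast
    then have "w (r + 2) = q + 1 - c r * q" "w (r + 2) \<le> 1" using x[of r] DEC range by auto
    then have "c r \<noteq> 0" using q by auto
    then obtain k where k: "c r = Suc k" by (cases "c r") auto
    have "registers_ok q l' (c(r := k)) (reset {0} w)"
      unfolding registers_ok_def
    proof (intro conjI allI impI disjI1)
      fix j assume "j < K"
      then show "reset {0} w (j + 2) - reset {0} w 0 = 1 - real ((c(r := k)) j) * q"
        using x[of j] DEC k by (auto simp: algebra_simps)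
    next
      assume "l' = 2 \<or> l' = 5"
      then show "reset {0} w 1 - reset {0} w 0 = real ((c(r := k)) 0)"
        using DEC_bounds I DEC by fastforce
    qed
    then show ?thesis using I DEC k by (auto intro: mstep.dec)
  qed
qed

lemma registers_positive:
  assumes "registers_ok q l c w" "0 < q" "w 0 = 0" "j < K" "0 < w (j + 2)"
  shows "w (j + 2) = 1 - c j * q"
proof -
  have "0 \<le> c j * q" using assms(2) by simp
  moreover have "w (j + 2) = 1 - c j * q \<or> (\<exists>b. w (j + 2) = - (c j * q) - (if b then q else 0))"
    using assms(1,3,4) by (force simp: registers_ok_def)
  ultimately show ?thesis using assms(2,5) by (smt (verit))
qed

lemma edge_cases [consumes 1]:
  assumes "e \<in> edges A"
  obtains (turn) l I j where "(l, I) \<in> P" "j < K" "e = turn_edge l I j"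
  | ("end") l I where "(l, I) \<in> P" "e = end_edge K l I"
  | (overflow) l r l' where "(l, INC r l') \<in> P" "e = special_edge K l (INC r l')"
  | (zero) l r l' l'' where "(l, DEC r l' l'') \<in> P" "e = special_edge K l (DEC r l' l'')"
  | (skip) l l' where "l < M" "0 < l'" "l' < M" "e = skip_edge l l'"
  | (start) "e = start_edge" | (unit) "e = unit_edge" | (compare) "e = compare_edge"
  | ("output") "e = output_edge" | (load) "e = load_edge t" | (loaded) "e = loaded_edge t"
proof -
  note kinds = that
  from assms consider "e = load_edge t" | "e = loaded_edge t"
    | "e \<in> (\<lambda>((l, I), j). turn_edge l I j) ` (P \<times> {..<K})" | "e \<in> (\<lambda>(l, I). end_edge K l I) ` P"
    | "e \<in> (\<lambda>(l, I). special_edge K l I) ` P"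
    | "e \<in> (\<lambda>(l, l'). skip_edge l l') ` ({..<M} \<times> {0<..<M})"
    | "e = start_edge" | "e = unit_edge" | "e = compare_edge" | "e = output_edge"
    unfolding counter_pta_def base_edges_def pta.simps insert_iff Un_iff by blast
  then show thesis
  proof cases
    case 5
    then obtain l I where "(l, I) \<in> P" "e = special_edge K l I" by auto
    then show ?thesis by (cases I) (auto intro: kinds)
  qed (auto intro: kinds)
qed

lemma edges_A: "edges A = insert (load_edge t) (insert (loaded_edge t) (base_edges P K M))"
  by (simp add: counter_pta_def)

lemma turn_edge_in:
  assumes "(l, I) \<in> P" "j < K"
  shows "turn_edge l I j \<in> edges A"
proof -
  have "turn_edge l I j \<in> (\<lambda>((l, I), j). turn_edge l I j) ` (P \<times> {..<K})"
    using assms by (intro image_eqI[of _ _ "((l, I), j)"]) auto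
  then show ?thesis unfolding edges_A base_edges_def by blast
qed

lemma end_edge_in:
  assumes "(l, I) \<in> P"
  shows "end_edge K l I \<in> edges A"
proof -
  have "end_edge K l I \<in> (\<lambda>(l, I). end_edge K l I) ` P"
    using assms by (intro image_eqI[of _ _ "(l, I)"]) auto
  then show ?thesis unfolding edges_A base_edges_def by blast
qed

lemma special_edge_in:
  assumes "(l, I) \<in> P"
  shows "special_edge K l I \<in> edges A"
proof -
  have "special_edge K l I \<in> (\<lambda>(l, I). special_edge K l I) ` P"
    using assms by (intro image_eqI[of _ _ "(l, I)"]) auto
  then show ?thesis unfolding edges_A base_edges_def by blast
qed

lemma skip_edge_in:
  assumes "l < M" "0 < l'" "l' < M"
  shows "skip_edge l l' \<in> edges A"
proof -
  have "skip_edge l l' \<in> (\<lambda>(l, l'). skip_edge l l') ` ({..<M} \<times> {0<..<M})"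
    using assms by (intro image_eqI[of _ _ "(l, l')"]) auto
  then show ?thesis unfolding edges_A base_edges_def by blast
qed

lemma other_edges_in: "start_edge \<in> edges A" "unit_edge \<in> edges A" "compare_edge \<in> edges A"
    "output_edge \<in> edges A" "load_edge t \<in> edges A" "loaded_edge t \<in> edges A"
  unfolding edges_A base_edges_def by blast+

lemma edge_src_tgt:
  assumes "e \<in> edges A"
  shows "src e < M \<and> 0 < tgt e \<and> tgt e < M"
  using assms
proof (cases rule: edge_cases)
  case (turn l I j)
  then show ?thesis using label_bounds[of l I] by (auto simp: edge_defs)
next
  case ("end" l I)
  then show ?thesis using label_bounds[of l I] next_label_bounds[of l I] by (auto simp: edge_defs)
next
  case (overflow l r l')
  then show ?thesis using label_bounds[of l] M_ge by auto
next
  case (zero l r l' l'')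
  then show ?thesis using DEC_bounds[of l r l' l''] by auto
qed (use M_ge in \<open>auto simp: edge_defs\<close>)

lemma edge_act: "e \<in> edges A \<Longrightarrow> act e = 0 \<or> act e = 1 \<or> act e = 2 \<and> e = compare_edge"
  by (erule edge_cases) (auto simp: edge_defs)

lemma edge_graph:
  assumes "e \<in> edges A" "act e \<noteq> 1"
  shows "(src e, act e, tgt e) \<in> step_graph"
  using edge_src_tgt[OF assms(1)] edge_act[OF assms(1)] assms(2)
  by (auto simp: step_graph_def compare_edge_def)

lemma step_iff: "step A v (l, w) d e (l', w') \<longleftrightarrow> l < N \<and> l' < N \<and> (\<forall>x. 0 \<le> w x) \<and> (\<forall>x. 0 \<le> w' x) \<and>
    e \<in> edges A \<and> 0 \<le> d \<and> l = src e \<and> sat v (delay w d) (guard e) \<and> l' = tgt e \<and>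
    w' = reset (resets e) (delay w d)"
  by (auto simp: step_def states_def counter_pta_def)

lemma stepI: "l < M \<Longrightarrow> (\<forall>x. 0 \<le> w x) \<Longrightarrow> e \<in> edges A \<Longrightarrow> 0 \<le> d \<Longrightarrow> src e = l \<Longrightarrow>
    sat v (delay w d) (guard e) \<Longrightarrow> tgt e = l' \<Longrightarrow> w' = reset (resets e) (delay w d) \<Longrightarrow>
    step A v (l, w) d e (l', w')"
  using edge_src_tgt[of e] N_ge by (auto simp: step_iff)

text \<open>Every edge except \<open>skip_edge\<close> bounds clock 0 by \<open>1 + q\<close>, which
  rules out the first case of the invariant; the source location then selects among the others. The
  two kinds of edges with action 1 contradict \<open>safe\<close>.\<close>

lemma invariant_step:
  assumes inv: "invariant q s" and step: "step A v s d e s'" and safe: "safe q"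
    and v: "of_rat (v 0) = q" "of_rat (v 1) = q" and q: "0 \<le> q"
  shows "act e \<noteq> 1 \<and> invariant q s'"
proof -
  obtain l w l' w' where s: "s = (l, w)" "s' = (l', w')" by (cases s; cases s') auto
  define u where "u = delay w d"
  have st: "\<forall>x. 0 \<le> w x" "e \<in> edges A" "0 \<le> d" "l = src e" "sat v u (guard e)" "l' = tgt e"
    "w' = reset (resets e) u"
    using step unfolding s step_iff u_def by blast+
  have le: "w x \<le> u x" for x using st(3) by (simp add: u_def)
  have simulating: "\<exists>c. (mstep P t)\<^sup>*\<^sup>* (2, \<lambda>_. 0) (l, c) \<and> registers_ok q l c u \<and> 0 < q \<and>
      (\<forall>j<K. (real (c j) + 1) * q < 1) \<and> (l = 4 \<longrightarrow> c 1 = 0)"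
    if bound: "u 0 \<le> 1 + q" and l: "l \<noteq> 0" "l \<noteq> 1" "l \<noteq> 3"
  proof -
    have "w 0 \<le> 1 + q" using bound le[of 0] by linarith
    then obtain c where "0 < q" "(mstep P t)\<^sup>*\<^sup>* (2, \<lambda>_. 0) (l, c)" "registers_ok q l c w"
      using inv l by (auto simp: invariant_def s Let_def)
    then show ?thesis using safe registers_ok_delay unfolding safe_def u_def by metis
  qed
  have uniform: "(\<forall>x. u x = u 0) \<and> (l = 1 \<longrightarrow> 0 < q)" if "u 0 \<le> 1 + q" "l = 0 \<or> l = 1"
  proof -
    have "w 0 \<le> 1 + q" using that(1) le[of 0] by linarith
    moreover have "\<not> (mstep P t)\<^sup>*\<^sup>* (2, \<lambda>_. 0) (l, c)" for c
      using that(2) reachable_label[of t "\<lambda>_. 0" l c] by auto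
    ultimately show ?thesis using inv that(2) by (auto simp: invariant_def s Let_def u_def)
  qed
  have simulatingI: "invariant q (l'', w'')"
    if "(mstep P t)\<^sup>*\<^sup>* (2, \<lambda>_. 0) (l'', c'')" "registers_ok q l'' c'' w''" "0 < q" for l'' c'' w''
    using that by (auto simp: invariant_def)
  from st(2) show ?thesis unfolding s
  proof (cases rule: edge_cases)
    case (turn m I j)
    have m: "m = l" "l' = l" "w' = reset {j + 2} u" using turn st by (auto simp: edge_defs)
    have g: "u (j + 2) = (if param_reset I j then q + 1 else 1)"
      "u 0 < (if param_reset I j then q + 1 else 1)"
      using turn st v by (auto simp: edge_defs split: if_splits)
    then have "u 0 \<le> 1 + q" using q by (auto split: if_splits)
    then obtain c where c: "(mstep P t)\<^sup>*\<^sup>* (2, \<lambda>_. 0) (l, c)" "registers_ok q l c u" "0 < q"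
      using simulating label_bounds[OF turn(1)] m by auto
    have "registers_ok q l c w'" unfolding m by (rule turn_sound) (use turn m c g in auto)
    then show "act e \<noteq> 1 \<and> invariant q (l', w')"
      using c turn m simulatingI by (auto simp: edge_defs)
  next
    case ("end" m I)
    have m: "m = l" "l' = next_label I" "w' = reset {0} u" using "end" st by (auto simp: edge_defs)
    have g: "u 0 = (if param_length I then q + 1 else 1)" "\<forall>j<K. 0 < u (j + 2) \<and> u (j + 2) \<le> 1"
      using "end" st v by (auto simp: edge_defs split: if_splits)
    then have "u 0 \<le> 1 + q" using q by (auto split: if_splits)
    then obtain c where c: "(mstep P t)\<^sup>*\<^sup>* (2, \<lambda>_. 0) (l, c)" "registers_ok q l c u" "0 < q"
        "\<forall>j<K. (real (c j) + 1) * q < 1"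
      using simulating label_bounds[OF "end"(1)] m by auto
    obtain c' where c': "mstep P t (l, c) (l', c')" "registers_ok q l' c' w'"
      using end_sound[OF _ c(2) c(3) g c(4)] "end"(1) m by auto
    then show "act e \<noteq> 1 \<and> invariant q (l', w')"
      using c "end" simulatingI[OF rtranclp.rtrancl_into_rtrancl[OF c(1) c'(1)] c'(2)]
      by (auto simp: edge_defs)
  next
    case (overflow m r m')
    have m: "m = l" using overflow st by auto
    have g: "u 0 = 0" "0 < u (r + 2)" "u (r + 2) \<le> q" using overflow st v by auto
    obtain c where c: "registers_ok q l c u" "0 < q" "\<forall>j<K. (real (c j) + 1) * q < 1"
      using simulating label_bounds[OF overflow(1)] m g q by auto
    have r: "r < K" using INC_bounds[OF overflow(1)] K_ge by auto
    then have "u (r + 2) = 1 - c r * q" using registers_positive[OF c(1,2)] g by auto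
    then have False using c(3) r g by (fastforce simp: algebra_simps)
    then show "act e \<noteq> 1 \<and> invariant q (l', w')" ..
  next
    case (zero m r m1 m2)
    have m: "m = l" "l' = m2" "w' = u" using zero st by auto
    have g: "u 0 = 0" "u (r + 2) = 1" "\<forall>j<K. 0 < u (j + 2) \<and> u (j + 2) \<le> 1" using zero st v by auto
    obtain c where c: "(mstep P t)\<^sup>*\<^sup>* (2, \<lambda>_. 0) (l, c)" "registers_ok q l c u" "0 < q"
      using simulating label_bounds[OF zero(1)] m g q by auto
    have x: "u (j + 2) = 1 - c j * q" if "j < K" for j
      using registers_positive[OF c(2,3)] g that by auto
    have "r < K" using DEC_bounds[OF zero(1)] by auto
    then have "c r = 0" using x[of r] g c(3) by auto
    then have "mstep P t (l, c) (l', c)" using zero m by (auto intro: mstep.zero)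
    moreover have "registers_ok q l' c w'"
      using x g m DEC_bounds[OF zero(1)] by (auto simp: registers_ok_def)
    ultimately show "act e \<noteq> 1 \<and> invariant q (l', w')"
      using simulatingI[OF rtranclp.rtrancl_into_rtrancl[OF c(1)]] c(3) zero by auto
  next
    case (skip m m')
    then show "act e \<noteq> 1 \<and> invariant q (l', w')" using st v by (auto simp: edge_defs invariant_def)
  next
    case start
    then have g: "0 < u 0" "u 0 \<le> q" "l = 0" "l' = 1" "w' = u" using st v by (auto simp: edge_defs)
    then have "u 0 \<le> 1 + q" "0 < q" by linarith+
    then have "\<forall>x. u x = u 0" using uniform g(3) by blast
    then have "invariant q (1, u)"
      using \<open>0 < q\<close> le_refl[of "1::nat"] unfolding invariant_def Let_def fst_conv snd_conv by blast
    then show "act e \<noteq> 1 \<and> invariant q (l', w')"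
      using g start by (simp add: edge_defs)
  next
    case unit
    then have g: "u 0 = 1" "l = 1" "l' = 2" "w' = reset {0, 1} u" using st v by (auto simp: edge_defs)
    then have "u 0 \<le> 1 + q" using q by linarith
    then have "\<forall>x. u x = 1" "0 < q" using uniform g(1,2) by metis+
    then have "registers_ok q 2 (\<lambda>_. 0) w'" using g by (auto simp: registers_ok_def)
    then show "act e \<noteq> 1 \<and> invariant q (l', w')"
      using g unit \<open>0 < q\<close> simulatingI[of 2 "\<lambda>_. 0"] by (auto simp: edge_defs)
  next
    case compare
    then show "act e \<noteq> 1 \<and> invariant q (l', w')" using st by (auto simp: edge_defs invariant_def)
  next
    case "output"
    then have g: "u 0 = 0" "0 < u 3" "u 3 < 1" "l = 4" using st v by (auto simp: edge_defs)
    then obtain c where c: "registers_ok q l c u" "0 < q" "c 1 = 0"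
      using simulating q by auto
    have "u 3 = 1 - c 1 * q" using registers_positive[OF c(1,2), of 1] g K_ge by (simp add: eval_nat_numeral)
    then have False using c g by auto
    then show "act e \<noteq> 1 \<and> invariant q (l', w')" ..
  next
    case load
    then have g: "u 0 = 0" "u 1 < t" "l = 2" "l' = 5" "w' = u" using st v by (auto simp: edge_defs)
    then obtain c where c: "(mstep P t)\<^sup>*\<^sup>* (2, \<lambda>_. 0) (l, c)" "registers_ok q l c u" "0 < q"
      using simulating q by auto
    have "registers_ok q 5 c u" using c(2) g label_bounds by (fastforce simp: registers_ok_def)
    moreover have "mstep P t (l, c) (5, c)" using c(2) g by (auto intro!: mstep.load simp: registers_ok_def)
    ultimately show "act e \<noteq> 1 \<and> invariant q (l', w')"
      using g load simulatingI[OF rtranclp.rtrancl_into_rtrancl[OF c(1)]] c(3) by (auto simp: edge_defs)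
  next
    case loaded
    then have g: "u 0 = 0" "u 1 = t" "l = 2" "l' = 6" "w' = u" using st v by (auto simp: edge_defs)
    then obtain c where c: "(mstep P t)\<^sup>*\<^sup>* (2, \<lambda>_. 0) (l, c)" "registers_ok q l c u" "0 < q"
      using simulating q by auto
    have "registers_ok q 6 c u" using c(2) g label_bounds by (fastforce simp: registers_ok_def)
    moreover have "mstep P t (l, c) (6, c)" using c(2) g by (auto intro!: mstep.loaded simp: registers_ok_def)
    ultimately show "act e \<noteq> 1 \<and> invariant q (l', w')"
      using g loaded simulatingI[OF rtranclp.rtrancl_into_rtrancl[OF c(1)]] c(3) by (auto simp: edge_defs)
  qed
qed

end

section \<open>Traces of the automaton\<close>

lemma language_eq: "language A v = map_word snd ` traces A v"
proof -
  have "map_word snd (word_of n (\<lambda>i. (fst (s i), act (e i)))) = word_of n (\<lambda>i. act (e i))"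
    for n s e by (simp add: word_of_def o_def split: enat.split)
  then show ?thesis unfolding language_def traces_def image_def by (smt (verit) Collect_cong mem_Collect_eq)
qed

context machine
begin

definition paths :: "(nat \<times> nat) word set" where
  "paths = {Inf f |f. fst (f 0) = 0 \<and> (\<forall>i. (fst (f i), snd (f i), fst (f (Suc i))) \<in> step_graph)}"

end

context machine_pta
begin

lemma step_good:
  "step A v s d e s' \<Longrightarrow> fst s < M \<and> fst s' < M \<and> (\<forall>x. 0 \<le> snd s' x)"
  using edge_src_tgt[of e] by (cases s; cases s') (auto simp: step_iff)

lemma skip_step:
  assumes "fst s < M" "\<forall>x. 0 \<le> snd s x" "0 \<le> v 0" "0 < l" "l < M"
  shows "step A v s (of_rat (v 0) + 2) (skip_edge (fst s) l) (l, delay (snd s) (of_rat (v 0) + 2))"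
proof -
  obtain m w where s: "s = (m, w)" by (cases s)
  have "0 \<le> (of_rat (v 0) :: real)" using assms(3) by simp
  moreover have "0 < 1 + w 0" using assms(2) s by (simp add: add_pos_nonneg)
  ultimately show ?thesis unfolding s
    using assms by (intro stepI) (auto simp: s skip_edge_def skip_edge_in[unfolded skip_edge_def])
qed

lemma run_good:
  assumes "run A v n s d e"
  shows "enat i \<le> n \<Longrightarrow> fst (s i) < M \<and> (\<forall>x. 0 \<le> snd (s i) x)"
proof (induction i)
  case 0
  then show ?case using assms M_ge by (auto simp: run_def counter_pta_def)
next
  case (Suc i)
  then have "step A v (s i) (d i) (e i) (s (Suc i))"
    using assms by (auto simp: run_def Suc_ile_eq)
  then show ?case using step_good by blast
qed

text \<open>Waiting enables some \<open>skip_edge\<close> in every state of a run, so no finite run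
  is maximal.\<close>

lemma run_infinite:
  assumes "run A v n s d e" "0 \<le> v 0"
  shows "n = \<infinity>"
proof (rule ccontr)
  assume "n \<noteq> \<infinity>"
  then obtain k where k: "n = enat k" by auto
  then have "fst (s k) < M \<and> (\<forall>x. 0 \<le> snd (s k) x)" using run_good assms(1) by blast
  then have "\<exists>d' e' s'. step A v (s k) d' e' s'"
    using skip_step[of "s k" v 1] assms(2) M_ge by fastforce
  then show False using assms(1) k by (auto simp: run_def)
qed

lemma traces_subset_paths:
  assumes "0 \<le> v 0" "v 0 = v 1" "safe (of_rat (v 0))"
  shows "traces A v \<subseteq> paths"
proof
  fix W assume "W \<in> traces A v"
  then obtain n s d e where W: "W = word_of n (\<lambda>i. (fst (s i), act (e i)))" and run: "run A v n s d e"
    by (auto simp: traces_def)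
  have n: "n = \<infinity>" using run_infinite[OF run assms(1)] .
  have st: "step A v (s i) (d i) (e i) (s (Suc i))" for i
    using run n by (auto simp: run_def)
  have s0: "s 0 = (0, \<lambda>x. 0)" using run by (simp add: run_def counter_pta_def)
  have inv: "invariant (of_rat (v 0)) (s i)" for i
  proof (induction i)
    case 0
    then show ?case by (simp add: s0 invariant_def)
  next
    case (Suc i)
    then show ?case using invariant_step[OF _ st] assms by auto
  qed
  have "act (e i) \<noteq> 1" for i using invariant_step[OF inv st assms(3)] assms(1,2) by simp
  then have "(src (e i), act (e i), tgt (e i)) \<in> step_graph" for i
    using st[of i] by (intro edge_graph) (auto simp: step_def)
  moreover have "src (e i) = fst (s i)" "tgt (e i) = fst (s (Suc i))" for i
    using st[of i] by (auto simp: step_def)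
  ultimately show "W \<in> paths"
    by (auto simp: W n word_of_def paths_def s0)
qed

lemma paths_subset_traces:
  assumes "0 \<le> v 0" "v 0 \<le> v 1"
  shows "paths \<subseteq> traces A v"
proof
  fix W assume "W \<in> paths"
  then obtain f where W: "W = Inf f" and f0: "fst (f 0) = 0"
    and f: "\<And>i. (fst (f i), snd (f i), fst (f (Suc i))) \<in> step_graph"
    by (auto simp: paths_def)
  define r :: real where "r = of_rat (v 0)"
  have r: "0 \<le> r" "r \<le> of_rat (v 1)" using assms by (simp_all add: r_def of_rat_less_eq)
  \<comment> \<open>Waiting for exactly the lower-bound value meets both bounds of
    \<open>compare_edge\<close>. Waiting 2 longer enables \<open>skip_edge\<close> whatever clock 0
    showed before.\<close>
  define d where "d i = (if snd (f i) = 2 then r else r + 2)" for i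
  define e where "e i = (if snd (f i) = 2 then compare_edge else skip_edge (fst (f i)) (fst (f (Suc i))))" for i
  define T where "T i = (\<Sum>k<i. d k)" for i
  define s where "s i = (fst (f i), \<lambda>_::nat. T i)" for i
  have d: "0 \<le> d i" for i using r by (simp add: d_def)
  have T: "0 \<le> T i" for i using d by (simp add: T_def sum_nonneg)
  have st: "step A v (s i) (d i) (e i) (s (Suc i))" for i
  proof (cases "snd (f i) = 2")
    case True
    then have "fst (f i) = 0" "fst (f (Suc i)) = 3" using f[of i] by (auto simp: step_graph_def)
    \<comment> \<open>The delay \<open>r\<close> fits \<open>compare_edge\<close> only if clock 0 is
      still 0, that is, in the first step.\<close>
    moreover have "i = 0"
    proof (rule ccontr)
      assume "i \<noteq> 0"
      then obtain k where "i = Suc k" by (cases i) auto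
      then show False using f[of k] \<open>fst (f i) = 0\<close> by (auto simp: step_graph_def)
    qed
    ultimately show ?thesis unfolding s_def
      using True r M_ge other_edges_in(3) by (intro stepI) (auto simp: e_def d_def T_def compare_edge_def r_def delay_def)
  next
    case False
    then have "fst (f i) < M" "0 < fst (f (Suc i))" "fst (f (Suc i)) < M"
      using f[of i] by (auto simp: step_graph_def)
    then show ?thesis
      using skip_step[of "s i" v "fst (f (Suc i))"] False T assms(1)
      by (simp add: s_def e_def d_def r_def T_def delay_def)
  qed
  have "run A v \<infinity> s d e"
    using st M_ge N_ge f0 by (auto simp: run_def s_def T_def counter_pta_def states_def)
  moreover have "W = word_of \<infinity> (\<lambda>i. (fst (s i), act (e i)))"
  proof -
    have "act (e i) = snd (f i)" for i
      using f[of i] by (auto simp: e_def compare_edge_def skip_edge_def step_graph_def)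
    then show ?thesis by (simp add: W word_of_def s_def)
  qed
  ultimately show "W \<in> traces A v" unfolding traces_def by blast
qed

lemma traces_eq_paths:
  assumes "0 \<le> v 0" "v 0 = v 1" "safe (of_rat (v 0))"
  shows "traces A v = paths"
  using traces_subset_paths[OF assms] paths_subset_traces[of v] assms by auto

lemma action_2_in_paths: "\<exists>W\<in>map_word snd ` paths. 2 \<in> set_word W"
proof -
  define f :: "nat \<Rightarrow> nat \<times> nat" where "f i = (if i = 0 then (0, 2) else (3, 0))" for i
  have "Inf f \<in> paths" using M_ge by (auto simp: paths_def f_def step_graph_def)
  moreover have "2 \<in> set_word (map_word snd (Inf f))" by (auto simp: f_def image_iff intro: exI[of _ 0])
  ultimately show ?thesis by blast
qed

lemma action_1_notin_paths: "W \<in> map_word snd ` paths \<Longrightarrow> 1 \<notin> set_word W"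
proof -
  have "snd (f i) \<noteq> 1" if "(fst (f i), snd (f i), fst (f (Suc i))) \<in> step_graph" for f :: "nat \<Rightarrow> nat \<times> nat" and i
    using that by (auto simp: step_graph_def)
  then show "W \<in> map_word snd ` paths \<Longrightarrow> 1 \<notin> set_word W" by (fastforce simp: paths_def)
qed

lemma action_2_notin_language:
  assumes "v 1 < v 0" "W \<in> language A v"
  shows "2 \<notin> set_word W"
proof
  assume 2: "2 \<in> set_word W"
  obtain n s d e where run: "run A v n s d e" and W: "W = word_of n (\<lambda>i. act (e i))"
    using assms(2) by (auto simp: language_def)
  obtain i where i: "enat i < n" "act (e i) = 2"
    using 2 by (auto simp: W word_of_def split: enat.splits)
  then have "step A v (s i) (d i) (e i) (s (Suc i))" using run by (auto simp: run_def)
  then have e: "e i \<in> edges A" "sat v (delay (snd (s i)) (d i)) (guard (e i))" by (auto simp: step_def)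
  then have "e i = compare_edge" using edge_act i by force
  then have "(of_rat (v 0) :: real) \<le> of_rat (v 1)" using e(2) by (auto simp: compare_edge_def)
  then show False using assms(1) by (simp add: of_rat_less_eq)
qed

abbreviation reaches :: "pvaluation \<Rightarrow> state \<Rightarrow> state \<Rightarrow> bool" where
  "reaches v \<equiv> (\<lambda>s s'. \<exists>d e. step A v s d e s')\<^sup>*\<^sup>*"

lemma step_reaches: "step A v s d e s' \<Longrightarrow> reaches v s' s'' \<Longrightarrow> reaches v s s''"
  by (rule converse_rtranclp_into_rtranclp) auto

lemma reaches_step: "reaches v s s' \<Longrightarrow> step A v s' d e s'' \<Longrightarrow> reaches v s s''"
  by (rule rtranclp.rtrancl_into_rtrancl) auto

text \<open>The language consists of words of maximal runs, so the finite sequence of steps is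
  prolonged by infinitely many skips to location 3.\<close>

lemma action_1_in_language:
  assumes "reaches v (0, \<lambda>_. 0) s" "step A v s d e s'" "act e = 1" "0 \<le> v 0"
  shows "\<exists>W\<in>language A v. 1 \<in> set_word W"
proof -
  let ?R = "\<lambda>s s'. \<exists>d e. step A v s d e s'"
  obtain n f where f: "f 0 = (0, \<lambda>_. 0)" "f n = s" "\<forall>i<n. ?R (f i) (f (Suc i))"
    using assms(1) by (auto simp: rtranclp_power relpowp_fun_conv)
  define h where "h k = ((\<lambda>s. (3::nat, delay (snd s) (of_rat (v 0) + 2))) ^^ k) s'" for k :: nat
  have h: "?R (h k) (h (Suc k)) \<and> fst (h k) < M \<and> (\<forall>x. 0 \<le> snd (h k) x)" for k
  proof (induction k)
    case 0
    have "fst s' < M \<and> (\<forall>x. 0 \<le> snd s' x)" using step_good assms(2) by blast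
    then show ?case using skip_step[of s' v 3] assms(4) M_ge by (auto simp: h_def)
  next
    case (Suc k)
    then have "fst (h (Suc k)) < M \<and> (\<forall>x. 0 \<le> snd (h (Suc k)) x)" using step_good by blast
    then show ?case using skip_step[of "h (Suc k)" v 3] assms(4) M_ge by (auto simp: h_def)
  qed
  define g where "g i = (if i \<le> n then f i else h (i - Suc n))" for i
  have "\<exists>d e. step A v (g i) d e (g (Suc i)) \<and> (i = n \<longrightarrow> act e = 1)" for i
  proof -
    consider "i < n" | "i = n" | "n < i" by linarith
    then show ?thesis
    proof cases
      case 1
      then show ?thesis using f(3) by (auto simp: g_def)
    next
      case 2
      then show ?thesis using assms(2,3) f(2) by (auto simp: g_def h_def)
    next
      case 3
      then have "Suc i - Suc n = Suc (i - Suc n)" by simp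
      then show ?thesis using h[of "i - Suc n"] 3 by (simp add: g_def)
    qed
  qed
  then obtain d e where st: "\<And>i. step A v (g i) (d i) (e i) (g (Suc i))" and n: "act (e n) = 1"
    by metis
  have "run A v \<infinity> g d e"
    using st f(1) by (auto simp: run_def g_def counter_pta_def states_def) (use M_ge N_ge in auto)
  then have "word_of \<infinity> (\<lambda>i. act (e i)) \<in> language A v" unfolding language_def by blast
  moreover have "1 \<in> set_word (word_of \<infinity> (\<lambda>i. act (e i)))"
    using n by (auto simp: word_of_def image_iff intro: exI[of _ n])
  ultimately show ?thesis by blast
qed

end

section \<open>Faithful simulation for a positive upper-bound parameter\<close>

locale simulation = machine_pta +
  fixes v :: pvaluation and p :: real
  assumes p: "p = of_rat (v 1)" "0 < p" and lower: "0 \<le> v 0" "v 0 \<le> v 1"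
begin

text \<open>For unequal parameters \<open>at_bound\<close> admits a whole interval; the simulated
  run always uses its upper end.\<close>

definition bound :: "bool \<Rightarrow> real" where
  "bound b = (if b then p + 1 else 1)"

definition matches :: "nat \<Rightarrow> (nat \<Rightarrow> nat) \<Rightarrow> cvaluation \<Rightarrow> bool" where
  "matches l c w \<longleftrightarrow> l < M \<and> (\<forall>x. 0 \<le> w x) \<and> w 0 = 0 \<and>
     (\<forall>j<K. w (j + 2) = 1 - c j * p \<and> c j * p < 1) \<and> (l = 2 \<or> l = 5 \<longrightarrow> w 1 = c 0)"

lemma lower_le: "0 \<le> (of_rat (v 0) :: real)" "of_rat (v 0) \<le> p"
  using lower by (simp_all add: p of_rat_less_eq)

lemma upper [simp]: "of_rat (v (Suc 0)) = p"
  using p(1) by simp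

lemma sat_bounds:
  "w x = bound b \<Longrightarrow> sat v w (at_bound x b)"
  "w x < bound b \<Longrightarrow> sat v w (below_bound x b)"
  using lower_le by (auto simp: bound_def split: if_splits)

text \<open>The registers are reset one after the other, in the order in which they reach their bounds.\<close>

lemma turns:
  assumes I: "(l, I) \<in> P" and U: "U \<subseteq> {..<K}" and nonneg: "\<forall>x. 0 \<le> w x"
    and len: "w 0 \<le> bound (param_length I)"
    and turn: "\<forall>j\<in>U. w (j + 2) \<le> bound (param_reset I j) \<and> w 0 < w (j + 2) \<and>
      w 0 + (bound (param_reset I j) - w (j + 2)) \<le> bound (param_length I)"
  shows "\<exists>w'. reaches v (l, w) (l, w') \<and> (\<forall>x. 0 \<le> w' x) \<and> w' 0 \<le> bound (param_length I) \<and>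
    (\<forall>j\<in>U. w' (j + 2) - w' 0 = w (j + 2) - w 0 - bound (param_reset I j)) \<and>
    (\<forall>x. x \<notin> (\<lambda>j. j + 2) ` U \<longrightarrow> w' x - w' 0 = w x - w 0)"
  using U nonneg len turn
proof (induction "card U" arbitrary: U w)
  case 0
  then have "U = {}" using finite_subset by fastforce
  then show ?case using 0 by auto
next
  case (Suc n)
  let ?B = "\<lambda>j. bound (param_reset I j)"
  let ?wait = "\<lambda>j. ?B j - w (j + 2)"
  have U: "finite U" "U \<noteq> {}" using Suc.hyps(2) card.infinite by fastforce+
  define j where "j = arg_min_on ?wait U"
  have j: "j \<in> U" "\<And>i. i \<in> U \<Longrightarrow> ?wait j \<le> ?wait i"
    using arg_min_if_finite[OF U] arg_min_least[OF U] by (auto simp: j_def)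
  define w1 where "w1 = reset {j + 2} (delay w (?wait j))"
  have wait: "0 \<le> ?wait j" using Suc.prems(4) j(1) by auto
  have w1: "w1 (j + 2) = 0" "\<And>x. x \<noteq> j + 2 \<Longrightarrow> w1 x = w x + ?wait j"
    by (simp_all add: w1_def)
  have nonneg: "\<forall>x. 0 \<le> w1 x" using Suc.prems(2) wait by (auto simp: w1_def add_nonneg_nonneg)
  have "step A v (l, w) (?wait j) (turn_edge l I j) (l, w1)"
  proof (rule stepI)
    show "sat v (delay w (?wait j)) (guard (turn_edge l I j))"
      using Suc.prems(4) j(1) by (simp add: turn_edge_def sat_bounds del: sat_at_bound sat_below_bound)
    show "turn_edge l I j \<in> edges A" using turn_edge_in[OF I] Suc.prems(1) j(1) by auto
  qed (use label_bounds[OF I] Suc.prems(2) wait w1_def in \<open>auto simp: turn_edge_def\<close>)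
  moreover have "\<exists>w'. reaches v (l, w1) (l, w') \<and> (\<forall>x. 0 \<le> w' x) \<and> w' 0 \<le> bound (param_length I) \<and>
    (\<forall>i\<in>U - {j}. w' (i + 2) - w' 0 = w1 (i + 2) - w1 0 - ?B i) \<and>
    (\<forall>x. x \<notin> (\<lambda>j. j + 2) ` (U - {j}) \<longrightarrow> w' x - w' 0 = w1 x - w1 0)"
  proof (rule Suc.hyps(1))
    show "n = card (U - {j})" using Suc.hyps(2) j(1) U by simp
    show "U - {j} \<subseteq> {..<K}" using Suc.prems(1) by auto
    show "w1 0 \<le> bound (param_length I)" using Suc.prems(4) j(1) w1 by auto
    show "\<forall>i\<in>U - {j}. w1 (i + 2) \<le> ?B i \<and> w1 0 < w1 (i + 2) \<and>
        w1 0 + (?B i - w1 (i + 2)) \<le> bound (param_length I)"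
    proof
      fix i assume i: "i \<in> U - {j}"
      then have "w1 (i + 2) = w (i + 2) + ?wait j" "w1 0 = w 0 + ?wait j" using w1(2) by auto
      moreover have "?wait j \<le> ?wait i" using i j(2) by auto
      ultimately show "w1 (i + 2) \<le> ?B i \<and> w1 0 < w1 (i + 2) \<and>
        w1 0 + (?B i - w1 (i + 2)) \<le> bound (param_length I)"
        using Suc.prems(4) i by auto
    qed
  qed (rule nonneg)
  then obtain w' where w': "reaches v (l, w1) (l, w')" "\<forall>x. 0 \<le> w' x" "w' 0 \<le> bound (param_length I)"
    "\<forall>i\<in>U - {j}. w' (i + 2) - w' 0 = w1 (i + 2) - w1 0 - ?B i"
    "\<forall>x. x \<notin> (\<lambda>j. j + 2) ` (U - {j}) \<longrightarrow> w' x - w' 0 = w1 x - w1 0" by blast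
  ultimately have "reaches v (l, w) (l, w')"
    by (blast intro: step_reaches)
  moreover have "w' (i + 2) - w' 0 = w (i + 2) - w 0 - ?B i" if "i \<in> U" for i
  proof (cases "i = j")
    case True
    have "j + 2 \<notin> (\<lambda>j. j + 2) ` (U - {j})" by auto
    then have "w' (j + 2) - w' 0 = w1 (j + 2) - w1 0" using w'(5) by blast
    then show ?thesis using True w1 by auto
  next
    case False
    then show ?thesis using w'(4) w1 that by auto
  qed
  moreover have "w' x - w' 0 = w x - w 0" if "x \<notin> (\<lambda>j. j + 2) ` U" for x
  proof -
    have "x \<noteq> j + 2" using that j(1) by auto
    then have "w1 x - w1 0 = w x - w 0" using w1 by auto
    moreover have "w' x - w' 0 = w1 x - w1 0" using w'(5) that by blast
    ultimately show ?thesis by simp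
  qed
  ultimately show ?case using w'(2,3) by blast
qed

text \<open>The numbers in \<open>range'\<close> are the register clocks at the end of the cycle.
  That they are positive means that every reset happens before that end.\<close>

lemma cycle:
  assumes I: "(l, I) \<in> P" and w: "\<forall>x. 0 \<le> w x" "w 0 = 0"
    and range: "\<forall>j<K. 0 < w (j + 2) \<and> w (j + 2) \<le> 1"
    and range': "\<forall>j<K. 0 < w (j + 2) + bound (param_length I) - bound (param_reset I j) \<and>
      w (j + 2) + bound (param_length I) - bound (param_reset I j) \<le> 1"
  shows "\<exists>w'. reaches v (l, w) (next_label I, w') \<and> (\<forall>x. 0 \<le> w' x) \<and> w' 0 = 0 \<and>
    w' 1 = w 1 + bound (param_length I) \<and>
    (\<forall>j<K. w' (j + 2) = w (j + 2) + bound (param_length I) - bound (param_reset I j))"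
proof -
  let ?L = "bound (param_length I)"
  have bound: "1 \<le> bound b" for b using p by (simp add: bound_def)
  have "\<exists>w'. reaches v (l, w) (l, w') \<and> (\<forall>x. 0 \<le> w' x) \<and> w' 0 \<le> ?L \<and>
    (\<forall>j\<in>{..<K}. w' (j + 2) - w' 0 = w (j + 2) - w 0 - bound (param_reset I j)) \<and>
    (\<forall>x. x \<notin> (\<lambda>j. j + 2) ` {..<K} \<longrightarrow> w' x - w' 0 = w x - w 0)"
  proof (rule turns[OF I subset_refl w(1)])
    show "w 0 \<le> ?L" using bound[of "param_length I"] w by simp
    show "\<forall>j\<in>{..<K}. w (j + 2) \<le> bound (param_reset I j) \<and> w 0 < w (j + 2) \<and>
        w 0 + (bound (param_reset I j) - w (j + 2)) \<le> ?L"
    proof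
      fix j assume "j \<in> {..<K}"
      then show "w (j + 2) \<le> bound (param_reset I j) \<and> w 0 < w (j + 2) \<and>
        w 0 + (bound (param_reset I j) - w (j + 2)) \<le> ?L"
        using range range' w(2) bound[of "param_reset I j"] by (smt (verit) lessThan_iff)
    qed
  qed
  then obtain w' where w': "reaches v (l, w) (l, w')" "\<forall>x. 0 \<le> w' x" "w' 0 \<le> ?L"
    "\<forall>j<K. w' (j + 2) - w' 0 = w (j + 2) - w 0 - bound (param_reset I j)"
    "\<forall>x. x \<notin> (\<lambda>j. j + 2) ` {..<K} \<longrightarrow> w' x - w' 0 = w x - w 0" by auto
  define w'' where "w'' = reset {0} (delay w' (?L - w' 0))"
  have w''_1: "w'' 1 = w 1 + ?L" using w'(5)[rule_format, of 1] w(2) by (auto simp: w''_def)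
  have w''_j: "w'' (j + 2) = w (j + 2) + ?L - bound (param_reset I j)" if "j < K" for j
    using w'(4) w(2) that by (auto simp: w''_def)
  have "step A v (l, w') (?L - w' 0) (end_edge K l I) (next_label I, w'')"
  proof (rule stepI)
    have "\<forall>j<K. 0 < (delay w' (?L - w' 0)) (j + 2) \<and> (delay w' (?L - w' 0)) (j + 2) \<le> 1"
    proof (intro allI impI)
      fix j assume j: "j < K"
      have "delay w' (?L - w' 0) (j + 2) = w (j + 2) + ?L - bound (param_reset I j)"
        using w''_j[OF j] by (simp add: w''_def)
      then show "0 < (delay w' (?L - w' 0)) (j + 2) \<and> (delay w' (?L - w' 0)) (j + 2) \<le> 1"
        using range' j by presburger
    qed
    then show "sat v (delay w' (?L - w' 0)) (guard (end_edge K l I))"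
      by (simp add: end_edge_def sat_bounds del: sat_at_bound)
    show "end_edge K l I \<in> edges A" using end_edge_in[OF I] .
  qed (use label_bounds[OF I] w' w''_def in \<open>auto simp: end_edge_def\<close>)
  then have "reaches v (l, w) (next_label I, w'')"
    by (rule reaches_step[OF w'(1)])
  moreover have "\<forall>x. 0 \<le> w'' x" using w'(2,3) by (auto simp: w''_def add_nonneg_nonneg)
  moreover have "w'' 0 = 0" by (simp add: w''_def)
  ultimately show ?thesis using w''_1 w''_j by blast
qed

lemma mstep_simulated:
  assumes match: "matches l c w" and step: "mstep P t (l, c) (l', c')"
  shows "(\<exists>w'. reaches v (l, w) (l', w') \<and> matches l' c' w') \<or>
    (\<exists>d e s'. step A v (l, w) d e s' \<and> act e = 1)"
proof -
  have w: "l < M" "\<forall>x. 0 \<le> w x" "w 0 = 0" "\<And>j. j < K \<Longrightarrow> w (j + 2) = 1 - c j * p"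
    "\<And>j. j < K \<Longrightarrow> c j * p < 1" "l = 2 \<or> l = 5 \<Longrightarrow> w 1 = c 0"
    using match by (auto simp: matches_def)
  have range: "0 < w (j + 2) \<and> w (j + 2) \<le> 1" if "j < K" for j
  proof -
    have "0 \<le> c j * p" using p(2) by simp
    then show ?thesis using w(4,5)[OF that] by linarith
  qed
  have delay_0: "delay w 0 = w" by (simp add: delay_def)
  have reach1: "reaches v (l, w) (m, w)" if "step A v (l, w) 0 e (m, w)" for m e
    using that by blast
  from step show ?thesis
  proof cases
    case (inc r)
    have r: "r < K" using INC_bounds[OF inc(2)] K_ge by auto
    have cp: "0 \<le> c r * p" using p(2) by simp
    show ?thesis
    proof (cases "c r * p + p < 1")
      case True
      let ?I = "INC r l'"
      have "\<exists>w'. reaches v (l, w) (next_label ?I, w') \<and> (\<forall>x. 0 \<le> w' x) \<and> w' 0 = 0 \<and>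
        w' 1 = w 1 + bound (param_length ?I) \<and>
        (\<forall>j<K. w' (j + 2) = w (j + 2) + bound (param_length ?I) - bound (param_reset ?I j))"
        using w(4) range True p(2) cp
        by (intro cycle[OF inc(2) w(2,3)]) (auto simp: bound_def simp del: mult_nonneg_nonneg zero_le_mult_iff)
      then obtain w' where w': "reaches v (l, w) (l', w')" "\<forall>x. 0 \<le> w' x" "w' 0 = 0"
        "w' 1 = w 1 + 1" "\<forall>j<K. w' (j + 2) = w (j + 2) + 1 - bound (j = r)"
        by (auto simp: bound_def)
      have "matches l' c' w'"
        unfolding matches_def
      proof (intro conjI allI impI)
        show "l' < M" using INC_bounds[OF inc(2)] M_ge by auto
      next
        fix j assume "j < K"
        then show "w' (j + 2) = 1 - c' j * p" "c' j * p < 1"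
          using w'(5) w(4,5)[of j] True inc by (auto simp: bound_def algebra_simps)
      next
        assume "l' = 2 \<or> l' = 5"
        then have "l = 5" "r = 0" using INC_bounds[OF inc(2)] by auto
        then show "w' 1 = c' 0" using w(6) w'(4) inc by auto
      qed (use w' in auto)
      then show ?thesis using w'(1) by blast
    next
      case False
      have "step A v (l, w) 0 (special_edge K l (INC r l')) (3, w)"
        using special_edge_in[OF inc(2)] w r range[OF r] False M_ge
        by (intro stepI) (auto simp: delay_0)
      then show ?thesis by fastforce
    qed
  next
    case (dec r l'' k)
    let ?I = "DEC r l' l''"
    have r: "r < K" using DEC_bounds[OF dec(2)] by auto
    have wr: "w (r + 2) = 1 - (k * p + p)" "k * p + p < 1" using w(4,5)[OF r] dec by (auto simp: algebra_simps)
    have kp: "0 \<le> k * p" using p(2) by simp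
    have "\<exists>w'. reaches v (l, w) (next_label ?I, w') \<and> (\<forall>x. 0 \<le> w' x) \<and> w' 0 = 0 \<and>
      w' 1 = w 1 + bound (param_length ?I) \<and>
      (\<forall>j<K. w' (j + 2) = w (j + 2) + bound (param_length ?I) - bound (param_reset ?I j))"
      using range wr kp p(2) by (intro cycle[OF dec(2) w(2,3)]) (auto simp: bound_def)
    then obtain w' where w': "reaches v (l, w) (l', w')" "\<forall>x. 0 \<le> w' x" "w' 0 = 0"
      "\<forall>j<K. w' (j + 2) = w (j + 2) + (p + 1) - bound (j \<noteq> r)"
      by (auto simp: bound_def)
    have "matches l' c' w'"
      unfolding matches_def
    proof (intro conjI allI impI)
      show "l' < M" using DEC_bounds[OF dec(2)] by auto
    next
      fix j assume "j < K"
      then show "w' (j + 2) = 1 - c' j * p" "c' j * p < 1"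
        using w'(4) w(4,5)[of j] wr p(2) dec by (auto simp: bound_def)
    next
      assume "l' = 2 \<or> l' = 5"
      then show "w' 1 = c' 0" using DEC_bounds[OF dec(2)] by auto
    qed (use w' in auto)
    then show ?thesis using w'(1) by blast
  next
    case (zero r l'')
    have r: "r < K" "l' < M" using DEC_bounds[OF zero(2)] by auto
    have "step A v (l, w) 0 (special_edge K l (DEC r l'' l')) (l', w)"
      using special_edge_in[OF zero(2)] w r range zero
      by (intro stepI) (auto simp: delay_0)
    moreover have "matches l' c' w" using match zero r DEC_bounds[OF zero(2)] by (auto simp: matches_def)
    ultimately show ?thesis using reach1 by blast
  next
    case load
    have "step A v (l, w) 0 (load_edge t) (l', w)"
      using other_edges_in w load M_ge by (intro stepI) (auto simp: delay_0 load_edge_def)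
    moreover have "matches l' c' w" using match load M_ge by (auto simp: matches_def)
    ultimately show ?thesis using reach1 by blast
  next
    case loaded
    have "step A v (l, w) 0 (loaded_edge t) (l', w)"
      using other_edges_in w loaded M_ge by (intro stepI) (auto simp: delay_0 loaded_edge_def)
    moreover have "matches l' c' w" using match loaded M_ge by (auto simp: matches_def)
    ultimately show ?thesis using reach1 by blast
  qed
qed

lemma start: "\<exists>w. reaches v (0, \<lambda>_. 0) (2, w) \<and> matches 2 (\<lambda>_. 0) w"
proof -
  \<comment> \<open>The delay must be positive and at most \<open>p\<close> for
    \<open>start_edge\<close>, and at most 1 so that \<open>unit_edge\<close> is not missed.\<close>
  define d where "d = min 1 p"
  define w where "w = reset {0, 1} (\<lambda>_. 1)"
  have d: "0 < d" "d \<le> 1" "d \<le> p" using p(2) by (auto simp: d_def)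
  have "step A v (0, \<lambda>_. 0) d start_edge (1, \<lambda>_. d)"
    using d other_edges_in M_ge by (intro stepI) (auto simp: start_edge_def delay_def)
  moreover have "step A v (1, \<lambda>_. d) (1 - d) unit_edge (2, w)"
    using d other_edges_in M_ge by (intro stepI) (auto simp: unit_edge_def delay_def w_def)
  ultimately have "reaches v (0, \<lambda>_. 0) (2, w)"
    by (blast intro: step_reaches rtranclp.rtrancl_refl)
  moreover have "matches 2 (\<lambda>_. 0) w" using M_ge by (auto simp: matches_def w_def)
  ultimately show ?thesis by blast
qed

lemma action_1_if_output:
  assumes "(mstep P t)\<^sup>*\<^sup>* (2, \<lambda>_. 0) (4, c)" "c 1 \<noteq> 0"
  shows "\<exists>W\<in>language A v. 1 \<in> set_word W"
proof -
  define failed where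
    "failed \<longleftrightarrow> (\<exists>s d e s'. reaches v (0, \<lambda>_. 0) s \<and> step A v s d e s' \<and> act e = 1)"
  have "failed \<or> (\<exists>w. reaches v (0, \<lambda>_. 0) (fst b, w) \<and> matches (fst b) (snd b) w)"
    if "(mstep P t)\<^sup>*\<^sup>* (2, \<lambda>_. 0) b" for b
    using that
  proof (induction rule: rtranclp_induct)
    case base
    then show ?case using start by simp
  next
    case (step b b')
    show ?case
    proof (cases failed)
      case False
      then obtain w where w: "reaches v (0, \<lambda>_. 0) (fst b, w)" "matches (fst b) (snd b) w"
        using step.IH by blast
      from mstep_simulated[OF w(2), of "fst b'" "snd b'"] step.hyps(2) consider
        w' where "reaches v (fst b, w) (fst b', w')" "matches (fst b') (snd b') w'"
        | d e s' where "step A v (fst b, w) d e s'" "act e = 1" by auto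
      then show ?thesis
      proof cases
        case 1
        then show ?thesis using rtranclp_trans[OF w(1)] by blast
      next
        case 2
        then show ?thesis using w(1) unfolding failed_def by blast
      qed
    qed simp
  qed
  from this[OF assms(1)] have failed
  proof
    assume "\<exists>w. reaches v (0, \<lambda>_. 0) (fst (4::nat, c), w) \<and> matches (fst (4::nat, c)) (snd (4::nat, c)) w"
    then obtain w where w: "reaches v (0, \<lambda>_. 0) (4, w)" "matches 4 c w" by auto
    have w3: "w 3 = 1 - c 1 * p" "c 1 * p < 1"
      using w(2) K_ge by (auto simp: matches_def eval_nat_numeral)
    have "0 < c 1 * p" using assms(2) p(2) by simp
    then have "step A v (4, w) 0 output_edge (3, w)"
      using w(2) w3 other_edges_in by (intro stepI) (auto simp: matches_def output_edge_def delay_def)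
    then show failed using w(1) unfolding failed_def by (fastforce simp: output_edge_def)
  qed
  then show ?thesis using action_1_in_language lower unfolding failed_def by blast
qed

end

section \<open>The reduction\<close>

text \<open>The sets \<open>{..<t}\<close> are the padding, and the last summand \<open>t\<close> in
  the field of the edges is the code of \<open>base_edges\<close>.\<close>

definition pta_code :: "nat \<Rightarrow> nat" where
  "pta_code t = list_encode [set_encode {0, 1, 2}, set_encode {..<t}, 0, set_encode {..<t},
     set_encode {0, 1}, set_encode ((\<lambda>l. prod_encode (l, constr_code [])) ` {..<t}),
     2 ^ edge_code (load_edge t) + (2 ^ edge_code (loaded_edge t) + t),
     graph_code {0, 1} (\<lambda>_. rat_code 0)]"

lemma computable1_pta_code: "computable1 pta_code"
proof -
  have number: "computable1 (\<lambda>t. int_encode (int t))"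
    using computable1_add[OF computable1_id computable1_id]
    by (simp add: int_encode_def sum_encode_def mult_2)
  have "computable1 (\<lambda>t. edge_code (load_edge t))" "computable1 (\<lambda>t. edge_code (loaded_edge t))"
    unfolding load_edge_def loaded_edge_def edge_code.simps constr_code_def list.map atom_code.simps
    by (intro computable1_const computable1_list_encode_Cons number)+
  moreover have "computable1 (\<lambda>t. set_encode {..<t})"
    using computable1_set_encode_image_lessThan[OF computable1_id] by simp
  moreover have "computable1 (\<lambda>t. set_encode ((\<lambda>l. prod_encode (l, constr_code [])) ` {..<t}))"
    by (intro computable1_set_encode_image_lessThan computable1_prod_encode computable1_id
        computable1_const) (auto intro: injI)
  ultimately show ?thesis unfolding pta_code_def[abs_def]
    by (intro computable1_const computable1_list_encode_Cons computable1_add computable1_power2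
        computable1_id)
qed

context machine_pta
begin

lemma wf_A: "wf_pta A"
proof -
  have "wf_edge A e" if "e \<in> edges A" for e
  proof -
    have r: "list_all (wf_atom A) (in_range K)"
      using M_ge N_ge by (auto simp: in_range_def list_all_iff counter_pta_def)
    have "act e \<in> acts A" using edge_act[OF that] by (auto simp: counter_pta_def)
    moreover have "list_all (wf_atom A) (guard e) \<and> resets e \<subseteq> clocks A"
      using that
    proof (cases rule: edge_cases)
      case (overflow l r l')
      then have "r < K" using INC_bounds[OF overflow(1)] K_ge by auto
      then show ?thesis using overflow M_ge N_ge by (auto simp: counter_pta_def)
    next
      case (zero l r l' l'')
      then have "r < K" using DEC_bounds[OF zero(1)] by auto
      then show ?thesis using zero r M_ge N_ge by (auto simp: counter_pta_def)
    qed (use r M_ge N_ge in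
        \<open>auto simp: edge_defs at_bound_def below_bound_def counter_pta_def\<close>)
    ultimately show ?thesis
      using edge_src_tgt[OF that] N_ge by (auto simp: wf_edge_def counter_pta_def)
  qed
  moreover have "finite (edges A)"
    using finite_P by (simp add: counter_pta_def base_edges_def)
  ultimately show ?thesis using M_ge N_ge
    by (auto simp: wf_pta_def counter_pta_def)
qed

lemma lu_partition_A: "lu_partition A {0} {1}"
proof -
  have r: "\<forall>a\<in>set (in_range K). lu_atom {0} {1} a" by (auto simp: in_range_def)
  have "\<forall>a\<in>set (guard e). lu_atom {0} {1} a" if "e \<in> edges A" for e
    using that by (cases rule: edge_cases)
      (use r in \<open>auto simp: edge_defs at_bound_def below_bound_def split: if_splits\<close>)
  moreover have "invar A l = []" for l by (simp add: counter_pta_def)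
  moreover have "params A = {0, 1}" by (simp add: counter_pta_def)
  ultimately show ?thesis by (auto simp: lu_partition_def atoms_def)
qed

lemma pvaluations_A: "v \<in> pvaluations A \<longleftrightarrow> 0 \<le> v 0 \<and> 0 \<le> v 1 \<and> (\<forall>i>1. v i = 0)"
proof -
  have "i \<noteq> 0 \<and> i \<noteq> 1 \<longleftrightarrow> 1 < i" for i :: nat by auto
  then show ?thesis by (auto simp: pvaluations_def counter_pta_def)
qed

lemma instance_A: "(A, \<lambda>_. 0) \<in> lu_instances"
  using wf_A lu_partition_A by (auto simp: lu_instances_def pvaluations_A)

text \<open>The code of the fixed edges serves at once as padding and as the number to be loaded. As
  \<open>set_encode\<close> sums over distinct members, the two edges containing \<open>t\<close>
  have to differ from each other and from all fixed edges.\<close>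

lemma instance_code_A:
  assumes "N = set_encode (edge_code ` base_edges P K M)" "t = N"
  shows "instance_code (A, \<lambda>_. 0) = pta_code t"
proof -
  have fin: "finite (base_edges P K M)"
    using finite_P by (simp add: base_edges_def)
  have special: "Edge 2 g a R l' \<noteq> special_edge K l I" if "(l, I) \<in> P" for l I g a R l'
    using label_bounds[OF that] by (cases I) auto
  have label: "(2, I) \<notin> P" for I
    using label_bounds by fastforce
  have new: "load_edge t \<notin> base_edges P K M" "loaded_edge t \<notin> base_edges P K M"
    "load_edge t \<noteq> loaded_edge t"
    unfolding base_edges_def edge_defs by (auto simp: special label)
  have "edges A \<subseteq> {e. finite (resets e)}"
    using wf_A by (auto simp: wf_pta_def wf_edge_def dest: finite_subset)
  then have "inj_on edge_code (edges A)" using inj_on_edge_code inj_on_subset by blast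
  then have "edge_code (load_edge t) \<notin> insert (edge_code (loaded_edge t)) (edge_code ` base_edges P K M)"
    "edge_code (loaded_edge t) \<notin> edge_code ` base_edges P K M"
    using new unfolding edges_A inj_on_def by blast+
  then have "set_encode (edge_code ` edges A) =
      2 ^ edge_code (load_edge t) + (2 ^ edge_code (loaded_edge t) + t)"
    using fin assms unfolding edges_A by (simp add: set_encode_insert)
  then show ?thesis using assms(2)
    by (simp add: instance_code_def pta_code_def counter_pta_def graph_code_def
        del: list_encode.simps)
qed

lemma safe_0: "safe 0"
  by (simp add: safe_def)

lemma language_0: "language A (\<lambda>_. 0) = map_word snd ` paths"
  using traces_eq_paths[of "\<lambda>_. 0"] safe_0 by (simp add: language_eq)

lemma language_changes:
  assumes halt: "(mstep P t)\<^sup>*\<^sup>* (2, \<lambda>_. 0) (4, c)" "c 1 \<noteq> 0"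
    and v: "v \<in> pvaluations A" "v \<noteq> (\<lambda>_. 0)"
  shows "language A v \<noteq> language A (\<lambda>_. 0)"
proof (cases "v 1 < v 0")
  case True
  then show ?thesis
    using action_2_notin_language action_2_in_paths unfolding language_0 by metis
next
  case False
  have "v 1 \<noteq> 0"
  proof
    assume "v 1 = 0"
    then have "v i = 0" for i
      using v(1) False unfolding pvaluations_A by (cases "i = 0"; cases "i = 1") auto
    then show False using v(2) by auto
  qed
  then interpret simulation P K M N t v "of_rat (v 1)"
    using v(1) False unfolding pvaluations_A by unfold_locales auto
  show ?thesis
    using action_1_if_output[OF halt] action_1_notin_paths unfolding language_0 by metis
qed

text \<open>A halting run visits finitely many configurations, so its registers stay below some
  \<open>B\<close>, and \<open>1 / (B + 1)\<close> is small enough.\<close>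

lemma safe_if_output_0:
  assumes halt: "(mstep P t)\<^sup>*\<^sup>* (2, \<lambda>_. 0) (4, c)" "c 1 = 0"
  shows "\<exists>p'::rat. 0 < p' \<and> (\<forall>q. q \<le> of_rat p' \<longrightarrow> safe q)"
proof -
  let ?R = "{x. (mstep P t)\<^sup>*\<^sup>* (2, \<lambda>_. 0) x}"
  have R: "finite ?R" "\<And>x. x \<in> ?R \<Longrightarrow> (mstep P t)\<^sup>*\<^sup>* x (4, c)"
    using deterministic_reachable[OF mstep_deterministic mstep_stuck halt(1)] by auto
  have "finite ((\<lambda>(x, j). snd x j) ` (?R \<times> {..<K}))" using R(1) by simp
  then obtain B where "\<forall>n\<in>(\<lambda>(x, j). snd x j) ` (?R \<times> {..<K}). n < B"
    unfolding finite_nat_set_iff_bounded by blast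
  then have B: "snd x j < B" if "x \<in> ?R" "j < K" for x j
    using that by (cases x) (auto simp: image_iff)
  have "c' 1 = 0" if "(4, c') \<in> ?R" for c'
    using R(2)[OF that] by (cases rule: converse_rtranclpE) (use mstep_stuck halt(2) in auto)
  moreover have "(real (c' j) + 1) * q < 1"
    if q: "0 < q" "q \<le> 1 / (real B + 1)" and "(l, c') \<in> ?R" "j < K" for q l c' j
  proof -
    have "real (c' j) + 1 < real B + 1" using B[OF that(3,4)] by simp
    then have "(real (c' j) + 1) * q < (real B + 1) * q" using q(1) by simp
    also have "\<dots> \<le> (real B + 1) * (1 / (real B + 1))" using q(2) by (intro mult_left_mono) auto
    finally show ?thesis by simp
  qed
  ultimately have "safe q" if "q \<le> of_rat (1 / (of_nat B + 1))" for q
    using that by (auto simp: safe_def of_rat_divide of_rat_add)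
  then show ?thesis by (intro exI[of _ "1 / (of_nat B + 1)"]) auto
qed

text \<open>The witness gives both parameters the same small value, so the whole segment down to 0
  consists of equal, safe values, for which the simulation is exact.\<close>

lemma traces_preserved:
  assumes "(mstep P t)\<^sup>*\<^sup>* (2, \<lambda>_. 0) (4, c)" "c 1 = 0"
  shows "\<exists>v\<in>pvaluations A. v \<noteq> (\<lambda>_. 0) \<and> (\<forall>u\<in>segment A (\<lambda>_. 0) v. traces A u = traces A (\<lambda>_. 0))"
proof -
  obtain p' :: rat where p': "0 < p'" "\<And>q. q \<le> of_rat p' \<Longrightarrow> safe q"
    using safe_if_output_0[OF assms] by blast
  define v where "v i = (if i \<le> 1 then p' else 0)" for i :: nat
  have "v \<in> pvaluations A" using p' by (simp add: v_def pvaluations_A)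
  moreover have "v 0 \<noteq> 0" using p' by (simp add: v_def)
  moreover have "traces A u = traces A (\<lambda>_. 0)" if u: "u \<in> segment A (\<lambda>_. 0) v" for u
  proof -
    obtain s :: real where s: "0 \<le> s" "s \<le> 1" "\<And>i. of_rat (u i) = (1 - s) * of_rat (v i)"
      using u by (auto simp: segment_def)
    have "(of_rat (u 0) :: real) = of_rat (u 1)" using s(3)[of 0] s(3)[of 1] by (simp add: v_def)
    then have eq: "u 0 = u 1" by simp
    have "(1 - s) * of_rat p' \<le> 1 * of_rat p'" using s p'(1) by (intro mult_right_mono) auto
    then have "safe (of_rat (u 0))" using s(3)[of 0] by (intro p'(2)) (simp add: v_def)
    moreover have "0 \<le> u 0" using u by (simp add: segment_def pvaluations_A)
    ultimately have "traces A u = paths" using eq traces_eq_paths by blast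
    then show ?thesis using traces_eq_paths[of "\<lambda>_. 0"] safe_0 by simp
  qed
  ultimately show ?thesis by (metis (no_types))
qed

end

context machine
begin

lemma loading:
  "k \<le> t \<Longrightarrow> (mstep P t)\<^sup>*\<^sup>* (2, \<lambda>_. 0) (2, (\<lambda>_. 0)(0 := k))"
proof (induction k)
  case 0
  have "(\<lambda>_::nat. 0::nat)(0 := 0) = (\<lambda>_. 0)" by auto
  then show ?case by simp
next
  case (Suc k)
  let ?c = "(\<lambda>_. 0)(0 := k) :: nat \<Rightarrow> nat"
  have "mstep P t (2, ?c) (5, ?c)" using Suc.prems by (intro mstep.load) simp
  moreover have "mstep P t (5, ?c) (2, (\<lambda>_. 0)(0 := Suc k))"
    using mstep.inc[OF load_instr, of t ?c] by simp
  moreover have "(mstep P t)\<^sup>*\<^sup>* (2, \<lambda>_. 0) (2, ?c)"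
    by (rule Suc.IH) (use Suc.prems in simp)
  ultimately show ?case by (meson rtranclp.rtrancl_into_rtrancl)
qed

text \<open>This makes \<open>N = t\<close> large enough. The skip out of location
  \<open>M - 1\<close> has a code of at least \<open>M - 1\<close>, and it contributes the power of
  2 with this exponent.\<close>

lemma M_le_code: "M \<le> set_encode (edge_code ` base_edges P K M)"
proof -
  let ?e = "skip_edge (M - 1) 1"
  have fin: "finite (base_edges P K M)"
    using finite_P by (simp add: base_edges_def)
  have "?e \<in> (\<lambda>(l, l'). skip_edge l l') ` ({..<M} \<times> {0<..<M})"
    using M_ge by (intro image_eqI[of _ _ "(M - 1, 1)"]) auto
  then have "?e \<in> base_edges P K M" by (simp add: base_edges_def)
  then have "2 ^ edge_code ?e \<le> set_encode (edge_code ` base_edges P K M)"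
    using fin unfolding set_encode_def by (intro member_le_sum) auto
  moreover have "M - 1 \<le> edge_code ?e"
    using le_prod_encode_1 le_SucI by (fastforce simp: skip_edge_def)
  ultimately show ?thesis
    using less_exp[of "edge_code ?e"] by linarith
qed

end

lemma reduction:
  "\<exists>A t. (A, \<lambda>_. 0) \<in> lu_instances \<and> instance_code (A, \<lambda>_. 0) = pta_code t \<and>
     (rec_eval h [t] 0 \<longrightarrow> (\<exists>v\<in>pvaluations A. v \<noteq> (\<lambda>_. 0) \<and>
        (\<forall>u\<in>segment A (\<lambda>_. 0) v. traces A u = traces A (\<lambda>_. 0)))) \<and>
     (rec_eval h [t] 1 \<longrightarrow> (\<forall>v\<in>pvaluations A. v \<noteq> (\<lambda>_. 0) \<longrightarrow>
        language A v \<noteq> language A (\<lambda>_. 0)))"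
proof -
  define c where "c = compile h [0] 1 2"
  define P where "P = insert (5, INC 0 2) (set (flatten c 6 4))"
  define reg where "reg I = (case I of INC r l \<Rightarrow> r | DEC r l l' \<Rightarrow> r)" for I
  have "finite ((reg \<circ> snd) ` P)" by (simp add: P_def)
  then obtain K where K: "\<And>l I. (l, I) \<in> P \<Longrightarrow> reg I < K"
    unfolding finite_nat_set_iff_bounded by fastforce
  \<comment> \<open>Six labels are reserved, and \<open>com_size c\<close> are used by the program;
    the rest makes room for the clocks \<open>j + 2\<close> of the \<open>K + 2\<close>
    registers.\<close>
  define M where "M = 6 + com_size c + (K + 2) + 2"
  have fl: "6 \<le> l \<and> l < M \<and> (\<forall>k\<in>targets I. k < M \<and> (k = 4 \<or> 6 \<le> k))"
    if "(l, I) \<in> set (flatten c 6 4)" for l I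
    using flatten_label[OF that] flatten_targets[OF that] by (fastforce simp: M_def)
  interpret machine P "K + 2" M
  proof
    show "finite P" by (simp add: P_def)
    show "I = I'" if "(l, I) \<in> P" "(l, I') \<in> P" for l I I'
      using that fl[of l] flatten_functional[of l I c 6 4 I'] by (fastforce simp: P_def)
    show "(5, INC 0 2) \<in> P" by (simp add: P_def)
    show "l = 5 \<and> r = 0 \<and> l' = 2 \<or> 6 \<le> l \<and> l < M \<and> r < K + 2 \<and> l' < M \<and> (l' = 4 \<or> 6 \<le> l')"
      if "(l, INC r l') \<in> P" for l r l'
      using that fl[of l "INC r l'"] K[OF that] by (auto simp: P_def reg_def)
    show "6 \<le> l \<and> l < M \<and> r < K + 2 \<and> l' < M \<and> (l' = 4 \<or> 6 \<le> l') \<and> l'' < M \<and> (l'' = 4 \<or> 6 \<le> l'')"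
      if "(l, DEC r l' l'') \<in> P" for l r l' l''
      using that fl[of l "DEC r l' l''"] K[OF that] by (auto simp: P_def reg_def)
  qed (auto simp: M_def com_size_pos Suc_le_eq)
  \<comment> \<open>\<open>base_edges\<close> does not involve \<open>t\<close>, so this choice is
    not circular.\<close>
  define t where "t = set_encode (edge_code ` base_edges P (K + 2) M)"
  interpret machine_pta P "K + 2" M t t
    using M_le_code by unfold_locales (simp add: t_def)
  have halt: "(mstep P t)\<^sup>*\<^sup>* (2, \<lambda>_. 0) (4, (\<lambda>_. 0)(0 := t, 1 := y))" if "rec_eval h [t] y" for y
  proof -
    let ?s = "(\<lambda>_. 0)(0 := t)"
    have "exec c ?s (?s(1 := y))"
      unfolding c_def by (rule implementsD[OF implements_compile[OF that]]) auto
    then have "(mstep P t)\<^sup>*\<^sup>* (6, ?s) (4, ?s(1 := y))"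
      by (rule exec_imp_msteps) (auto simp: P_def)
    moreover have "mstep P t (2, ?s) (6, ?s)" by (rule mstep.loaded) simp
    ultimately show ?thesis
      using loading[of t t] by (meson converse_rtranclp_into_rtranclp order_refl rtranclp_trans)
  qed
  show ?thesis
  proof (intro exI conjI impI)
    show "(A, \<lambda>_. 0) \<in> lu_instances" by (rule instance_A)
    show "instance_code (A, \<lambda>_. 0) = pta_code t" by (rule instance_code_A) (simp_all add: t_def)
    show "\<exists>v\<in>pvaluations A. v \<noteq> (\<lambda>_. 0) \<and> (\<forall>u\<in>segment A (\<lambda>_. 0) v. traces A u = traces A (\<lambda>_. 0))"
      if "rec_eval h [t] 0"
      using traces_preserved[OF halt[OF that]] by simp
    show "\<forall>v\<in>pvaluations A. v \<noteq> (\<lambda>_. 0) \<longrightarrow> language A v \<noteq> language A (\<lambda>_. 0)"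
      if "rec_eval h [t] 1"
      using language_changes[OF halt[OF that]] by simp
  qed
qed

text \<open>The first hypothesis on \<open>Q\<close> starts from the strongest form of preservation,
  that of traces along a segment; the second starts from the strongest form of change, that of the
  language under every other valuation. Hence one reduction serves all three problems.\<close>

lemma undecidable:
  assumes preserved: "\<And>A. \<exists>v\<in>pvaluations A. v \<noteq> (\<lambda>_. 0) \<and>
      (\<forall>u\<in>segment A (\<lambda>_. 0) v. traces A u = traces A (\<lambda>_. 0)) \<Longrightarrow> Q (A, \<lambda>_. 0)"
    and changed: "\<And>A. \<forall>v\<in>pvaluations A. v \<noteq> (\<lambda>_. 0) \<longrightarrow> language A v \<noteq> language A (\<lambda>_. 0) \<Longrightarrow>
      \<not> Q (A, \<lambda>_. 0)"
  shows "\<not> decidable_on instance_code lu_instances Q"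
proof
  assume "decidable_on instance_code lu_instances Q"
  then obtain f where f: "\<And>x. x \<in> lu_instances \<Longrightarrow> rec_eval f [instance_code x] (if Q x then 1 else 0)"
    by (auto simp: decidable_on_def)
  obtain g where g: "\<And>t. rec_eval g [t] (pta_code t)"
    using computable1_pta_code by (auto simp: computable1_def)
  obtain A t where A: "(A, \<lambda>_. 0) \<in> lu_instances" "instance_code (A, \<lambda>_. 0) = pta_code t"
    and "rec_eval (Cn f [g]) [t] 0 \<Longrightarrow> Q (A, \<lambda>_. 0)"
    and "rec_eval (Cn f [g]) [t] 1 \<Longrightarrow> \<not> Q (A, \<lambda>_. 0)"
    using reduction[of "Cn f [g]"] preserved changed by metis
  moreover have "rec_eval (Cn f [g]) [t] (if Q (A, \<lambda>_. 0) then 1 else 0)"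
    using f[OF A(1)] g unfolding A(2) by (rule rec_eval_Cn1[rotated])
  ultimately show False by (cases "Q (A, \<lambda>_. 0)") auto
qed

lemma endpoint_in_segment: "v \<in> pvaluations A \<Longrightarrow> v \<in> segment A u v"
  unfolding segment_def by (auto intro: bexI[of _ 0])

theorem theorem5p11:
  shows "\<not> decidable_on instance_code lu_instances trace_preservation
    \<and> \<not> decidable_on instance_code lu_instances robust_language_preservation
    \<and> \<not> decidable_on instance_code lu_instances robust_trace_preservation"
proof (intro conjI undecidable)
  fix A :: pta
  let ?v = "\<lambda>_. 0"
  assume "\<exists>v\<in>pvaluations A. v \<noteq> ?v \<and> (\<forall>u\<in>segment A ?v v. traces A u = traces A ?v)"
  then obtain v where v: "v \<in> pvaluations A" "v \<noteq> ?v" "\<forall>u\<in>segment A ?v v. traces A u = traces A ?v"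
    by blast
  show "trace_preservation (A, ?v)" "robust_trace_preservation (A, ?v)"
    using v endpoint_in_segment unfolding trace_preservation_def robust_trace_preservation_def by auto
  show "robust_language_preservation (A, ?v)"
    using v unfolding robust_language_preservation_def language_eq by auto
next
  fix A :: pta
  let ?v = "\<lambda>_. 0"
  assume "\<forall>v\<in>pvaluations A. v \<noteq> ?v \<longrightarrow> language A v \<noteq> language A ?v"
  then show "\<not> trace_preservation (A, ?v)" "\<not> robust_trace_preservation (A, ?v)"
    "\<not> robust_language_preservation (A, ?v)"
    unfolding trace_preservation_def robust_trace_preservation_def robust_language_preservation_def
    using endpoint_in_segment by (auto simp: language_eq) metis+
qed

end
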